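(* Let $\mathcal{D}\subset\mathbb{R}^N$ be open, bounded, connected, let $F:\partial\mathcal{D}\to\mathbb{R}$ be continuous, and for $\epsilon\in(0,1)$ let $u^\epsilon(x)=\mathbb{E}[F\circ X^{\epsilon,x}]$, $x\in\mathcal{D}$. Let $J\subset(0,1)$ be a sequence decreasing to $0$, and assume that $\{u^\epsilon\}_{\epsilon\in J}$ converges locally uniformly in $\mathcal{D}$, as $\epsilon\to0$, $\epsilon\in J$, to some $u\in C(\mathcal{D})$. Then $u$ is harmonic in $\mathcal{D}$.
   Context: Probability space: $\Omega_1=B_1(0)\subset\mathbb{R}^N$ with Borel $\sigma$-algebra and normalised Lebesgue measure; $(\Omega,\mathcal{F},\mathbb{P})$ is the countable product $\Omega=(\Omega_1)^{\mathbb{N}}$, $\omega=\{w_i\}_{i\ge1}$. The $\epsilon$-ball walk started at $x\in\mathcal{D}$: $X_0^{\epsilon,x}\equiv x$, $X_n^{\epsilon,x}=X_{n-1}^{\epsilon,x}+\big(\epsilon\wedge\operatorname{dist}(X_{n-1}^{\epsilon,x},\partial\mathcal{D})\big)w_n$ for $n\ge1$; it converges $\mathbb{P}$-a.s. to a random variable $X^{\epsilon,x}:\Omega\to\partial\mathcal{D}$. *)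

theory Defs
  imports "HOL-Probability.Probability"
begin

definition ball_space :: "'a::euclidean_space measure" where
  "ball_space = uniform_measure lborel (ball 0 1)"

text \<open>Countable product space; the coordinate \<open>\<omega> n\<close> plays the role of \<open>w_(n+1)\<close>.\<close>
definition walk_space :: "(nat \<Rightarrow> 'a::euclidean_space) measure" where
  "walk_space = (\<Pi>\<^sub>M i\<in>(UNIV::nat set). ball_space)"

primrec ball_walk :: "real \<Rightarrow> 'a::euclidean_space set \<Rightarrow> 'a \<Rightarrow> (nat \<Rightarrow> 'a) \<Rightarrow> nat \<Rightarrow> 'a" where
  "ball_walk \<epsilon> D x \<omega> 0 = x"
| "ball_walk \<epsilon> D x \<omega> (Suc n) =
     ball_walk \<epsilon> D x \<omega> n
     + (min \<epsilon> (infdist (ball_walk \<epsilon> D x \<omega> n) (frontier D))) *\<^sub>R \<omega> n"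

definition walk_exit :: "real \<Rightarrow> 'a::euclidean_space set \<Rightarrow> 'a \<Rightarrow> (nat \<Rightarrow> 'a) \<Rightarrow> 'a" where
  "walk_exit \<epsilon> D x \<omega> = lim (ball_walk \<epsilon> D x \<omega>)"

definition walk_value :: "real \<Rightarrow> 'a::euclidean_space set \<Rightarrow> ('a \<Rightarrow> real) \<Rightarrow> 'a \<Rightarrow> real" where
  "walk_value \<epsilon> D F x = (\<integral>\<omega>. F (walk_exit \<epsilon> D x \<omega>) \<partial>walk_space)"

definition harmonic_on :: "'a::euclidean_space set \<Rightarrow> ('a \<Rightarrow> real) \<Rightarrow> bool" where
  "harmonic_on D u \<longleftrightarrow>
     u differentiable_on D \<and>
     (\<forall>b\<in>Basis. (\<lambda>y. frechet_derivative u (at y) b) differentiable_on D) \<and>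
     (\<forall>b\<in>Basis. \<forall>c\<in>Basis. continuous_on D
        (\<lambda>x. frechet_derivative (\<lambda>y. frechet_derivative u (at y) b) (at x) c)) \<and>
     (\<forall>x\<in>D. (\<Sum>b\<in>Basis. frechet_derivative (\<lambda>y. frechet_derivative u (at y) b) (at x) b) = 0)"

end

theory Submission
  imports Defs
begin

text \<open>
  By the Markov property, the values \<open>u\<^sup>\<epsilon>\<close> satisfy the exact mean value property on the balls of
  radius \<open>\<epsilon> \<and> dist(x, \<partial>D)\<close>. Test this against the kernels
  \<open>g\<^sub>k(t, y) = (t - |y|\<^sup>2)\<^sub>+\<^sup>k\<close>: Fubini moves the ball average onto the kernel, a third order
  Taylor expansion turns it into \<open>\<epsilon>\<^sup>2\<close> times a multiple of \<open>\<Delta>g\<^sub>k\<close> up to \<open>O(\<epsilon>\<^sup>3)\<close>, and in the limit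
  \<open>\<integral> u(x + y) \<Delta>g\<^sub>k(t, y) dy = 0\<close>.

  Since \<open>\<Delta>g\<^sub>k\<close> is a combination of \<open>g\<^sub>k\<^sub>-\<^sub>1\<close> and \<open>t g\<^sub>k\<^sub>-\<^sub>2\<close>, and \<open>\<partial>\<^sub>t g\<^sub>k = k g\<^sub>k\<^sub>-\<^sub>1\<close>, this is a
  first order linear equation in \<open>t\<close> for \<open>\<integral> u(x + y) g\<^sub>j(t, y) dy\<close>. Solving it and letting \<open>t\<close> tend to
  \<open>0\<close> shows that \<open>u\<close> equals its own average against the normalised kernel \<open>g\<^sub>5\<close>, so \<open>u\<close> is locally a
  convolution with a smooth enough kernel, and the same identity says that its Laplacian vanishes.

  Almost sure convergence of the walk is bypassed: all divergent walks receive the same junk limit,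
  and almost no convergent walk stops away from the boundary. The values of \<open>F\<close> off the boundary matter
  only through measurability: if \<open>F\<close> is not Borel, then \<open>F \<circ> X\<^sup>\<epsilon>\<^sup>,\<^sup>x\<close> is not measurable on the
  (incomplete) product space for any \<open>x \<in> D\<close>, and Isabelle's integral gives \<open>u\<^sup>\<epsilon> = 0\<close>.
\<close>

section \<open>Taylor expansion of the truncated kernels\<close>

text \<open>Away from 0 the function agrees locally with \<open>s ^ k\<close> or with 0. At 0 the
  difference quotient is at most \<open>\<bar>h\<bar> ^ (k - 1)\<close>, which tends to 0 because
  \<open>2 \<le> k\<close>.\<close>

lemma pos_part_power_deriv:
  fixes s :: real
  assumes "2 \<le> k"
  shows "((\<lambda>s. max 0 s ^ k) has_real_derivative real k * max 0 s ^ (k - 1)) (at s)"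
proof -
  consider "s > 0" | "s < 0" | "s = 0" by linarith
  then show ?thesis
  proof cases
    case 1
    have "((\<lambda>s. s ^ k) has_real_derivative real k * s ^ (k - 1)) (at s)"
      by (auto intro!: derivative_eq_intros)
    then have "((\<lambda>s. max 0 s ^ k) has_real_derivative real k * s ^ (k - 1)) (at s)"
      by (rule DERIV_cong_ev[THEN iffD1, rotated -1, OF _ refl _ refl])
         (use 1 in \<open>auto intro!: eventually_nhds_in_open[of "{0<..}", THEN eventually_mono]\<close>)
    then show ?thesis using 1 by simp
  next
    case 2
    have "((\<lambda>s. 0) has_real_derivative 0) (at s)" by simp
    then have "((\<lambda>s. max 0 s ^ k) has_real_derivative 0) (at s)"
      by (rule DERIV_cong_ev[THEN iffD1, rotated -1, OF _ refl _ refl])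
         (use 2 assms in \<open>auto intro!: eventually_nhds_in_open[of "{..<0}", THEN eventually_mono]\<close>)
    then show ?thesis using 2 assms by (simp add: power_0_left)
  next
    case 3
    have lim: "((\<lambda>h::real. \<bar>h\<bar> ^ (k - 1)) \<longlongrightarrow> 0) (at 0)"
      using assms by (auto intro!: tendsto_eq_intros simp: power_0_left)
    have "((\<lambda>h::real. max 0 h ^ k / h) \<longlongrightarrow> 0) (at 0)"
    proof (rule Lim_null_comparison[OF _ lim])
      have "norm (max 0 h ^ k / h) \<le> \<bar>h\<bar> ^ (k - 1)" for h :: real
      proof -
        have "\<bar>max 0 h\<bar> ^ k \<le> \<bar>h\<bar> ^ k" by (rule power_mono) auto
        also have "\<dots> = \<bar>h\<bar> ^ (k - 1) * \<bar>h\<bar>" using assms by (simp flip: power_Suc2)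
        finally show ?thesis by (cases "h = 0") (auto simp: power_abs field_simps)
      qed
      then show "\<forall>\<^sub>F h in at 0. norm (max 0 h ^ k / h) \<le> \<bar>h\<bar> ^ (k - 1)" by simp
    qed
    then show ?thesis using 3 assms by (simp add: has_field_derivative_iff power_0_left)
  qed
qed

text \<open>Taylor's theorem with Lagrange remainder. For \<open>m < n < k\<close> the
  \<open>m\<close>-th derivative still carries an exponent of at least 2, so it can be
  differentiated once more even at the kink; the intermediate point stays below \<open>T\<close>,
  which bounds the remainder.\<close>

lemma pos_part_power_taylor:
  fixes s s' :: real
  assumes "0 < n" "n < k" "s \<le> T" "s' \<le> T" "0 \<le> T"
  shows "\<bar>max 0 s' ^ k - (\<Sum>m<n. (real k gchoose m) * max 0 s ^ (k - m) * (s' - s) ^ m)\<bar>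
           \<le> (real k gchoose n) * T ^ (k - n) * \<bar>s' - s\<bar> ^ n"
proof (cases "s' = s")
  \<comment> \<open>Taylor's theorem is applied below to two distinct points. Here only the term
    \<open>m = 0\<close> survives.\<close>
  case True
  have "(\<Sum>m<n. (real k gchoose m) * max 0 s ^ (k - m) * (s - s) ^ m)
      = (\<Sum>m\<in>{0}. (real k gchoose m) * max 0 s ^ (k - m) * (s - s) ^ m)"
    using assms by (intro sum.mono_neutral_right) (auto simp: power_0_left)
  then show ?thesis using True assms by (simp add: power_0_left)
next
  case False
  \<comment> \<open>The \<open>m\<close>-th derivative of \<open>max 0 s ^ k\<close>: the binomial
    coefficient times the factorial is the falling factorial
    \<open>k (k - 1) ... (k - m + 1)\<close>, whose recursion is \<open>gs\<close>.\<close>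
  define d where "d m s = (real k gchoose m) * fact m * max 0 s ^ (k - m)" for m and s :: real
  have gs: "(real k gchoose Suc m) * fact (Suc m) = (real k gchoose m) * fact m * real (k - m)"
    if "m < k" for m
  proof -
    have "real k * (real k gchoose m) = real m * (real k gchoose m) + real (Suc m) * (real k gchoose Suc m)"
      by (rule gbinomial_mult_1)
    then have "real (Suc m) * (real k gchoose Suc m) = (real k - real m) * (real k gchoose m)"
      by (simp add: algebra_simps)
    then have "fact m * (real (Suc m) * (real k gchoose Suc m)) = fact m * ((real k - real m) * (real k gchoose m))"
      by simp
    then show ?thesis using that by (simp add: algebra_simps)
  qed
  have dd: "DERIV (d m) x :> d (Suc m) x" if "m < n" for m x
  proof -
    have "DERIV (\<lambda>x. (real k gchoose m) * fact m * max 0 x ^ (k - m)) x :>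
        (real k gchoose m) * fact m * (real (k - m) * max 0 x ^ (k - m - 1))"
      by (intro DERIV_cmult pos_part_power_deriv) (use that assms in auto)
    moreover have "(real k gchoose m) * fact m * (real (k - m) * max 0 x ^ (k - m - 1)) = d (Suc m) x"
      proof -
      have "(real k gchoose m) * fact m * real (k - m) = (real k gchoose Suc m) * fact (Suc m)"
        using gs[of m] that assms by linarith
      then show ?thesis unfolding d_def by (metis diff_Suc_eq_diff_pred diff_commute mult.assoc)
    qed
    moreover have "d m = (\<lambda>x. (real k gchoose m) * fact m * max 0 x ^ (k - m))"
      by (auto simp: d_def)
    ultimately show ?thesis by metis
  qed
  have d0: "d 0 = (\<lambda>s. max 0 s ^ k)" by (auto simp: d_def)
  have "\<exists>\<xi>. (if s' < s then s' < \<xi> \<and> \<xi> < s else s < \<xi> \<and> \<xi> < s') \<and>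
      max 0 s' ^ k = (\<Sum>m<n. d m s / fact m * (s' - s) ^ m) + d n \<xi> / fact n * (s' - s) ^ n"
    by (rule Taylor[where diff = d and f = "\<lambda>s. max 0 s ^ k" and a = "min s s'" and b = "max s s'"]) (use dd d0 assms(1) False in auto)
  then obtain \<xi> where \<xi>0: "if s' < s then s' < \<xi> \<and> \<xi> < s else s < \<xi> \<and> \<xi> < s'"
    and e: "max 0 s' ^ k = (\<Sum>m<n. d m s / fact m * (s' - s) ^ m) + d n \<xi> / fact n * (s' - s) ^ n"
    by blast
  have \<xi>: "\<xi> \<le> T" using \<xi>0 assms by (auto split: if_splits)
  have "max 0 s' ^ k - (\<Sum>m<n. (real k gchoose m) * max 0 s ^ (k - m) * (s' - s) ^ m)
      = (real k gchoose n) * max 0 \<xi> ^ (k - n) * (s' - s) ^ n"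
    using e by (simp add: d_def)
  moreover have "0 \<le> (real k gchoose n)"
    by (simp add: binomial_gbinomial[symmetric])
  moreover have "0 \<le> T ^ (k - n)" using assms by simp
  moreover have "max 0 \<xi> ^ (k - n) \<le> T ^ (k - n)" using \<xi> assms by (intro power_mono) auto
  ultimately show ?thesis
    by (auto simp: abs_mult power_abs intro!: mult_mono)
qed

lemma pos_part_power_taylor_2:
  fixes s s' :: real
  assumes "3 \<le> k" "s \<le> T" "s' \<le> T" "0 \<le> T"
  shows "\<bar>max 0 s' ^ k - max 0 s ^ k - real k * max 0 s ^ (k - 1) * (s' - s)\<bar>
           \<le> (real k gchoose 2) * T ^ (k - 2) * (s' - s)\<^sup>2"
proof -
  have "{..<2::nat} = {0, 1}" by auto
  then show ?thesis using pos_part_power_taylor[of 2 k s T s'] assms by (simp add: diff_diff_eq)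
qed

lemma pos_part_power_taylor_3:
  fixes s s' :: real
  assumes "4 \<le> k" "s \<le> T" "s' \<le> T" "0 \<le> T"
  shows "\<bar>max 0 s' ^ k - max 0 s ^ k - real k * max 0 s ^ (k - 1) * (s' - s)
             - (real k gchoose 2) * max 0 s ^ (k - 2) * (s' - s)\<^sup>2\<bar>
           \<le> (real k gchoose 3) * T ^ (k - 3) * \<bar>s' - s\<bar> ^ 3"
proof -
  have "{..<3::nat} = {0, 1, 2}" by auto
  then show ?thesis using pos_part_power_taylor[of 3 k s T s'] assms by (simp add: diff_diff_eq add.assoc)
qed

section \<open>The kernels: support, size, expansion in time and space\<close>

text \<open>The parameter \<open>t\<close> is the square of the support radius, so the base is
  affine in \<open>t\<close>, and a derivative in \<open>t\<close> or in \<open>y\<close> lowers the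
  exponent by one without producing square roots.\<close>

definition bump :: "nat \<Rightarrow> real \<Rightarrow> 'a::euclidean_space \<Rightarrow> real" where
  "bump k t y = max 0 (t - y \<bullet> y) ^ k"

lemma bump_nonneg: "0 \<le> bump k t y"
  by (simp add: bump_def)

lemma bump_le: "0 \<le> t \<Longrightarrow> bump k t y \<le> t ^ k"
  unfolding bump_def by (intro power_mono) auto

lemma bump_eq_0: "t \<le> R\<^sup>2 \<Longrightarrow> 0 \<le> R \<Longrightarrow> R \<le> norm y \<Longrightarrow> 0 < k \<Longrightarrow> bump k t y = 0"
  using power_mono[of R "norm y" 2] by (auto simp: bump_def power2_norm_eq_inner)

lemma borel_measurable_bump [measurable]: "bump k t \<in> borel_measurable borel"
  unfolding bump_def[abs_def] by measurable

text \<open>Write \<open>y \<bullet> y\<close> as \<open>t - (t - y \<bullet> y)\<close>; where the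
  bracket is negative every term vanishes, since \<open>0 < k\<close>. This is what later links
  averages against kernels of consecutive exponents.\<close>

lemma inner_mult_bump:
  assumes "0 < k" shows "(y \<bullet> y) * bump k t y = t * bump k t y - bump (Suc k) t y"
  using assms by (auto simp: bump_def max_def algebra_simps)

lemma bump_time_taylor:
  assumes "3 \<le> k" "t \<le> T" "t' \<le> T" "0 \<le> T"
  shows "\<bar>bump k t' y - bump k t y - real k * bump (k - 1) t y * (t' - t)\<bar>
           \<le> (real k gchoose 2) * T ^ (k - 2) * (t' - t)\<^sup>2"
  using pos_part_power_taylor_2[of k "t - y \<bullet> y" T "t' - y \<bullet> y"] assms inner_ge_zero[of y]
  by (simp add: bump_def)

text \<open>Moving \<open>y\<close> to \<open>y - h\<close> changes \<open>t - y \<bullet> y\<close>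
  by \<open>a = 2 * (y \<bullet> h) - h \<bullet> h\<close>, which is of order
  \<open>norm h\<close>. The quadratic part of \<open>a\<close> in the linear term joins the error,
  hence the second summand of the constant. The increment is \<open>y - h\<close> because in
  \<open>bump k t (z - x)\<close> the moving point is \<open>x\<close>.\<close>

lemma bump_space_taylor1:
  fixes y h :: "'a::euclidean_space"
  assumes "3 \<le> k" "0 \<le> t" "norm y \<le> R" "norm h \<le> 1"
  shows "\<bar>bump k t (y - h) - bump k t y - 2 * real k * (y \<bullet> h) * bump (k - 1) t y\<bar>
           \<le> ((real k gchoose 2) * t ^ (k - 2) * (2 * R + 1)\<^sup>2 + real k * t ^ (k - 1)) * (norm h)\<^sup>2"
proof -
  define a where "a = 2 * (y \<bullet> h) - h \<bullet> h"
  have a: "(t - (y - h) \<bullet> (y - h)) - (t - y \<bullet> y) = a"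
    by (simp add: a_def algebra_simps inner_commute)
  have R: "0 \<le> R" using assms(3) norm_ge_zero[of y] by linarith
  have "\<bar>y \<bullet> h\<bar> \<le> R * norm h"
    using Cauchy_Schwarz_ineq2[of y h] mult_right_mono[OF assms(3), of "norm h"] by simp
  moreover have "h \<bullet> h \<le> 1 * norm h"
    unfolding power2_norm_eq_inner[symmetric] power2_eq_square using assms by (intro mult_right_mono) auto
  ultimately have ab: "\<bar>a\<bar> \<le> (2 * R + 1) * norm h"
    unfolding a_def using inner_ge_zero[of h] by (simp only: distrib_right mult.assoc)
  have a2: "a\<^sup>2 \<le> ((2 * R + 1) * norm h)\<^sup>2"
    using ab R by (subst power2_abs[symmetric], intro power_mono) auto
  have "\<bar>bump k t (y - h) - bump k t y - real k * bump (k - 1) t y * a\<bar>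
      \<le> (real k gchoose 2) * t ^ (k - 2) * a\<^sup>2"
    using pos_part_power_taylor_2[of k "t - y \<bullet> y" t "t - (y - h) \<bullet> (y - h)"] assms
    unfolding a by (simp add: bump_def)
  also have "\<dots> \<le> (real k gchoose 2) * t ^ (k - 2) * ((2 * R + 1) * norm h)\<^sup>2"
    using a2 assms by (intro mult_left_mono) (auto simp: binomial_gbinomial[symmetric])
  finally have 1: "\<bar>bump k t (y - h) - bump k t y - real k * bump (k - 1) t y * a\<bar>
      \<le> (real k gchoose 2) * t ^ (k - 2) * (2 * R + 1)\<^sup>2 * (norm h)\<^sup>2"
    by (simp add: power_mult_distrib)
  have "\<bar>real k * bump (k - 1) t y * (h \<bullet> h)\<bar> \<le> real k * t ^ (k - 1) * (norm h)\<^sup>2"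
    using assms bump_le[of t "k - 1" y] bump_nonneg[of "k - 1" t y]
    by (auto simp: power2_norm_eq_inner abs_mult intro!: mult_right_mono mult_left_mono)
  moreover have "bump k t (y - h) - bump k t y - 2 * real k * (y \<bullet> h) * bump (k - 1) t y
      = (bump k t (y - h) - bump k t y - real k * bump (k - 1) t y * a)
        - real k * bump (k - 1) t y * (h \<bullet> h)"
    by (simp add: a_def algebra_simps)
  ultimately show ?thesis unfolding distrib_right using 1 by linarith
qed

text \<open>The same substitution one order further. Besides the Taylor remainder, the part of
  \<open>a\<^sup>2\<close> beyond \<open>4 * (y \<bullet> h)\<^sup>2\<close> has to be absorbed; the
  two contributions are the two summands of \<open>C\<close>.\<close>

lemma bump_space_taylor2:
  assumes "4 \<le> k" "0 \<le> t"
  obtains C where "0 \<le> C"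
    "\<And>y h::'a::euclidean_space. norm y \<le> R \<Longrightarrow> norm h \<le> 1 \<Longrightarrow>
      \<bar>bump k t (y - h) - bump k t y - 2 * real k * (y \<bullet> h) * bump (k - 1) t y
        + real k * (h \<bullet> h) * bump (k - 1) t y
        - 2 * real k * (real k - 1) * (y \<bullet> h)\<^sup>2 * bump (k - 2) t y\<bar> \<le> C * norm h ^ 3"
proof -
  \<comment> \<open>The absolute value makes \<open>C\<close> nonnegative also when \<open>R\<close>
    is negative and the bound is vacuous.\<close>
  define R' where "R' = \<bar>R\<bar>"
  define C where "C = (real k gchoose 3) * t ^ (k - 3) * (2 * R' + 1) ^ 3
     + (real k * (real k - 1) / 2) * t ^ (k - 2) * (4 * R' + 1)"
  have g2: "real k gchoose 2 = real k * (real k - 1) / 2"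
    by (simp add: gbinomial_prod_rev numeral_2_eq_2)
  show thesis
  proof
    show "0 \<le> C" using assms by (auto simp: C_def R'_def binomial_gbinomial[symmetric])
  next
    fix y h :: 'a assume yR: "norm y \<le> R" and h1: "norm h \<le> 1"
    define a where "a = 2 * (y \<bullet> h) - h \<bullet> h"
    have a: "(t - (y - h) \<bullet> (y - h)) - (t - y \<bullet> y) = a"
      by (simp add: a_def algebra_simps inner_commute)
    have R: "0 \<le> R'" "norm y \<le> R'" using yR by (auto simp: R'_def)
    have yh: "\<bar>y \<bullet> h\<bar> \<le> R' * norm h"
      using Cauchy_Schwarz_ineq2[of y h] mult_right_mono[OF R(2), of "norm h"] by simp
    have hh: "h \<bullet> h \<le> 1 * norm h"
      unfolding power2_norm_eq_inner[symmetric] power2_eq_square using h1 by (intro mult_right_mono) auto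
    have ab: "\<bar>a\<bar> \<le> (2 * R' + 1) * norm h"
      unfolding a_def using inner_ge_zero[of h] hh yh by (simp only: distrib_right mult.assoc)
    have a3: "\<bar>a\<bar> ^ 3 \<le> ((2 * R' + 1) * norm h) ^ 3"
      using ab R by (intro power_mono) auto
    have "\<bar>bump k t (y - h) - bump k t y - real k * bump (k - 1) t y * a
        - (real k gchoose 2) * bump (k - 2) t y * a\<^sup>2\<bar> \<le> (real k gchoose 3) * t ^ (k - 3) * \<bar>a\<bar> ^ 3"
      using pos_part_power_taylor_3[of k "t - y \<bullet> y" t "t - (y - h) \<bullet> (y - h)"] assms
      unfolding a by (simp add: bump_def)
    also have "\<dots> \<le> (real k gchoose 3) * t ^ (k - 3) * ((2 * R' + 1) * norm h) ^ 3"
      using a3 assms by (intro mult_left_mono) (auto simp: binomial_gbinomial[symmetric])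
    finally have 1: "\<bar>bump k t (y - h) - bump k t y - real k * bump (k - 1) t y * a
        - (real k * (real k - 1) / 2) * bump (k - 2) t y * a\<^sup>2\<bar>
        \<le> (real k gchoose 3) * t ^ (k - 3) * (2 * R' + 1) ^ 3 * norm h ^ 3"
      by (simp add: power_mult_distrib g2)
    \<comment> \<open>The leftover of \<open>a\<^sup>2\<close> is a product of factors of order two
      and one in \<open>norm h\<close>, thus of third order.\<close>
    have "a\<^sup>2 - 4 * (y \<bullet> h)\<^sup>2 = (h \<bullet> h) * (h \<bullet> h - 4 * (y \<bullet> h))"
      by (simp add: a_def power2_eq_square algebra_simps)
    moreover have "\<bar>h \<bullet> h - 4 * (y \<bullet> h)\<bar> \<le> (4 * R' + 1) * norm h"
      using yh hh inner_ge_zero[of h] by (simp only: distrib_right mult.assoc)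
    ultimately have "\<bar>a\<^sup>2 - 4 * (y \<bullet> h)\<^sup>2\<bar> \<le> (norm h)\<^sup>2 * ((4 * R' + 1) * norm h)"
      by (auto simp: abs_mult power2_norm_eq_inner intro!: mult_left_mono)
    then have "\<bar>(real k * (real k - 1) / 2) * bump (k - 2) t y * (a\<^sup>2 - 4 * (y \<bullet> h)\<^sup>2)\<bar>
       \<le> (real k * (real k - 1) / 2) * t ^ (k - 2) * ((norm h)\<^sup>2 * ((4 * R' + 1) * norm h))"
      unfolding abs_mult using bump_nonneg[of "k - 2" t y] bump_le[of t "k - 2" y] assms
      by (intro mult_mono) auto
    also have "\<dots> = (real k * (real k - 1) / 2) * t ^ (k - 2) * (4 * R' + 1) * norm h ^ 3"
      by (simp add: power2_eq_square power3_eq_cube)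
    finally have 2: "\<bar>(real k * (real k - 1) / 2) * bump (k - 2) t y * (a\<^sup>2 - 4 * (y \<bullet> h)\<^sup>2)\<bar>
       \<le> (real k * (real k - 1) / 2) * t ^ (k - 2) * (4 * R' + 1) * norm h ^ 3" .
    have "bump k t (y - h) - bump k t y - 2 * real k * (y \<bullet> h) * bump (k - 1) t y
        + real k * (h \<bullet> h) * bump (k - 1) t y
        - 2 * real k * (real k - 1) * (y \<bullet> h)\<^sup>2 * bump (k - 2) t y
      = (bump k t (y - h) - bump k t y - real k * bump (k - 1) t y * a
        - (real k * (real k - 1) / 2) * bump (k - 2) t y * a\<^sup>2)
        + (real k * (real k - 1) / 2) * bump (k - 2) t y * (a\<^sup>2 - 4 * (y \<bullet> h)\<^sup>2)"
      by (simp add: a_def field_simps)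
    then show "\<bar>bump k t (y - h) - bump k t y - 2 * real k * (y \<bullet> h) * bump (k - 1) t y
        + real k * (h \<bullet> h) * bump (k - 1) t y
        - 2 * real k * (real k - 1) * (y \<bullet> h)\<^sup>2 * bump (k - 2) t y\<bar> \<le> C * norm h ^ 3"
      unfolding C_def distrib_right using 1 2 by linarith
  qed
qed

section \<open>Kernel averages and their derivatives\<close>

text \<open>This class holds the differences \<open>u - c\<close> cut off outside \<open>D\<close>.
  It is stable under multiplication by a coordinate, which reduces second derivatives of averages to
  first ones.\<close>

definition bounded_weight :: "('a::euclidean_space \<Rightarrow> real) \<Rightarrow> bool" where
  "bounded_weight m \<longleftrightarrow> m \<in> borel_measurable borel \<and> (\<exists>B. \<forall>z. \<bar>m z\<bar> \<le> B) \<and> (\<exists>R. \<forall>z. R < norm z \<longrightarrow> m z = 0)"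

lemma integrable_bounded_support:
  fixes f :: "'a::euclidean_space \<Rightarrow> real"
  assumes [measurable]: "f \<in> borel_measurable borel"
    and f: "\<And>z. \<bar>f z\<bar> \<le> C * indicator (cball x R) z"
  shows "integrable lborel f" "\<bar>\<integral>z. f z \<partial>lborel\<bar> \<le> C * measure lborel (cball x R)"
proof -
  have int: "integrable lborel (\<lambda>z. C * indicator (cball x R) z)"
    using emeasure_lborel_cball_finite[of x R] by (intro integrable_mult_right integrable_real_indicator) auto
  show i: "integrable lborel f"
    by (rule Bochner_Integration.integrable_bound[OF int]) (use f in \<open>auto intro!: AE_I2 intro: order_trans[OF _ abs_ge_self]\<close>)
  have "norm (\<integral>z. f z \<partial>lborel) \<le> (\<integral>z. C * indicator (cball x R) z \<partial>lborel)"
    using f by (intro Bochner_Integration.integral_norm_bound_integral i int) auto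
  then show "\<bar>\<integral>z. f z \<partial>lborel\<bar> \<le> C * measure lborel (cball x R)" by simp
qed

lemma integral_diff_diff_cmult:
  fixes f g h :: "'a \<Rightarrow> real"
  assumes "integrable M f" "integrable M g" "integrable M h"
  shows "(\<integral>z. f z \<partial>M) - (\<integral>z. g z \<partial>M) - c * (\<integral>z. h z \<partial>M) = (\<integral>z. f z - g z - c * h z \<partial>M)"
  using assms by simp

text \<open>The integrals see \<open>f\<close> only on a ball that contains the support of
  \<open>m\<close>. As \<open>K\<close> and \<open>R\<close> depend on \<open>m\<close> alone, a
  pointwise Taylor error on that ball becomes an error of the average.\<close>

lemma
  assumes "bounded_weight m"
  shows bounded_weight_integrable: "continuous_on UNIV f \<Longrightarrow> integrable lborel (\<lambda>z. m z * f z)"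
    and bounded_weight_bound: "\<exists>K R. \<forall>f C. continuous_on UNIV f \<longrightarrow>
      (\<forall>z. norm z \<le> R \<longrightarrow> \<bar>f z\<bar> \<le> C) \<longrightarrow> \<bar>\<integral>z. m z * f z \<partial>lborel\<bar> \<le> K * C"
proof -
  from assms obtain B R where [measurable]: "m \<in> borel_measurable borel"
    and B: "\<And>z. \<bar>m z\<bar> \<le> B" and R: "\<And>z. R < norm z \<Longrightarrow> m z = 0"
    by (auto simp: bounded_weight_def)
  have B0: "0 \<le> B" using B[of undefined] abs_ge_zero order_trans by blast
  have bd: "\<bar>m z * f z\<bar> \<le> (B * C) * indicator (cball 0 \<bar>R\<bar>) z"
    if "\<And>z. norm z \<le> \<bar>R\<bar> \<Longrightarrow> \<bar>f z\<bar> \<le> C" for f C z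
  proof (cases "norm z \<le> \<bar>R\<bar>")
    case True
    then show ?thesis using that[OF True] B[of z] B0 by (simp add: abs_mult mult_mono')
  next
    case False
    then show ?thesis using R[of z] by simp
  qed
  show "integrable lborel (\<lambda>z. m z * f z)" if f: "continuous_on UNIV f"
  proof -
    have [measurable]: "f \<in> borel_measurable borel" using f by (rule borel_measurable_continuous_onI)
    have "bounded (f ` cball 0 \<bar>R\<bar>)"
      using f by (intro compact_imp_bounded compact_continuous_image) (auto intro: continuous_on_subset)
    then obtain C where C: "\<And>z. norm z \<le> \<bar>R\<bar> \<Longrightarrow> \<bar>f z\<bar> \<le> C"
      unfolding bounded_iff real_norm_def by (metis image_eqI mem_cball_0)
    show ?thesis by (rule integrable_bounded_support(1)[OF _ bd[OF C]]) auto
  qed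
  show "\<exists>K R. \<forall>f C. continuous_on UNIV f \<longrightarrow>
      (\<forall>z. norm z \<le> R \<longrightarrow> \<bar>f z\<bar> \<le> C) \<longrightarrow> \<bar>\<integral>z. m z * f z \<partial>lborel\<bar> \<le> K * C"
  proof (intro exI allI impI)
    fix f :: "'a \<Rightarrow> real" and C
    assume f: "continuous_on UNIV f" and C: "\<forall>z. norm z \<le> \<bar>R\<bar> \<longrightarrow> \<bar>f z\<bar> \<le> C"
    then have [measurable]: "f \<in> borel_measurable borel" by (intro borel_measurable_continuous_onI)
    have "\<bar>\<integral>z. m z * f z \<partial>lborel\<bar> \<le> (B * C) * measure lborel (cball (0::'a) \<bar>R\<bar>)"
      by (rule integrable_bounded_support(2)[OF _ bd]) (use C in auto)
    then show "\<bar>\<integral>z. m z * f z \<partial>lborel\<bar> \<le> B * measure lborel (cball (0::'a) \<bar>R\<bar>) * C"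
      by (simp add: mult_ac)
  qed
qed

lemma bounded_weight_mult_inner:
  assumes "bounded_weight m"
  shows "bounded_weight (\<lambda>z. m z * (z \<bullet> b))"
proof -
  from assms obtain B R where [measurable]: "m \<in> borel_measurable borel"
    and B: "\<And>z. \<bar>m z\<bar> \<le> B" and R: "\<And>z. R < norm z \<Longrightarrow> m z = 0"
    by (auto simp: bounded_weight_def)
  have B0: "0 \<le> B" using B[of undefined] abs_ge_zero order_trans by blast
  have "\<bar>m z * (z \<bullet> b)\<bar> \<le> B * (\<bar>R\<bar> * norm b)" for z
  proof (cases "norm z \<le> \<bar>R\<bar>")
    case True
    have "\<bar>z \<bullet> b\<bar> \<le> \<bar>R\<bar> * norm b"
      using Cauchy_Schwarz_ineq2[of z b] mult_right_mono[OF True, of "norm b"] by simp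
    then show ?thesis unfolding abs_mult using B[of z] B0 by (intro mult_mono) auto
  next
    case False
    then show ?thesis using R[of z] B0 by simp
  qed
  then show ?thesis unfolding bounded_weight_def using R by (intro conjI exI[of _ "B * (\<bar>R\<bar> * norm b)"] exI[of _ R]) auto
qed

lemma continuous_on_bump [continuous_intros]:
  assumes "continuous_on S f" "continuous_on S g"
  shows "continuous_on S (\<lambda>z. bump k (f z) (g z))"
  unfolding bump_def by (intro continuous_intros assms)

text \<open>Dividing a quadratic remainder by \<open>norm h\<close> leaves something that tends to
  0. This turns the Taylor bounds for kernels into derivatives of averages without a theorem on
  differentiation under the integral.\<close>

lemma has_derivative_quadratic:
  fixes f :: "'a::real_normed_vector \<Rightarrow> 'b::real_normed_vector"
  assumes L: "bounded_linear L" and "0 < \<delta>"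
    and bd: "\<And>h. norm h < \<delta> \<Longrightarrow> norm (f (x + h) - f x - L h) \<le> K * (norm h)\<^sup>2"
  shows "(f has_derivative L) (at x)"
  unfolding has_derivative_at
proof (intro conjI L)
  have lim: "((\<lambda>h::'a. K * norm h) \<longlongrightarrow> 0) (at 0)" by (auto intro!: tendsto_eq_intros)
  show "((\<lambda>h. norm (f (x + h) - f x - L h) / norm h) \<longlongrightarrow> 0) (at 0)"
  proof (rule Lim_null_comparison[OF _ lim])
    have "norm (norm (f (x + h) - f x - L h) / norm h) \<le> K * norm h" if "norm h < \<delta>" for h
      using bd[OF that] by (cases "h = 0") (auto simp: field_simps power2_eq_square)
    then show "\<forall>\<^sub>F h in at 0. norm (norm (f (x + h) - f x - L h) / norm h) \<le> K * norm h"
      using \<open>0 < \<delta>\<close> by (auto simp: eventually_at intro!: exI[of _ \<delta>])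
  qed
qed

text \<open>As the kernel is even, this is the convolution of \<open>m\<close> with
  \<open>bump k t\<close>.\<close>

definition bump_avg :: "('a::euclidean_space \<Rightarrow> real) \<Rightarrow> nat \<Rightarrow> real \<Rightarrow> 'a \<Rightarrow> real" where
  "bump_avg m k t x = (\<integral>z. m z * bump k t (z - x) \<partial>lborel)"

text \<open>The differential of \<open>bump_avg m k t\<close> at \<open>x\<close> in direction
  \<open>h\<close>, taken under the integral; the chain rule for
  \<open>t - (z - x) \<bullet> (z - x)\<close> yields the factor
  \<open>2 * ((z - x) \<bullet> h)\<close>.\<close>

definition bump_grad :: "('a::euclidean_space \<Rightarrow> real) \<Rightarrow> nat \<Rightarrow> real \<Rightarrow> 'a \<Rightarrow> 'a \<Rightarrow> real" where
  "bump_grad m k t x h = 2 * real k * (\<integral>z. m z * (((z - x) \<bullet> h) * bump (k - 1) t (z - x)) \<partial>lborel)"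

lemma bump_avg_time_derivative:
  assumes m: "bounded_weight m" and "3 \<le> k" "0 < t"
  shows "((\<lambda>t. bump_avg m k t x) has_real_derivative real k * bump_avg m (k - 1) t x) (at t)"
proof -
  note int = bounded_weight_integrable[OF m]
  obtain K R where KR: "\<forall>f C. continuous_on UNIV f \<longrightarrow>
      (\<forall>z. norm z \<le> R \<longrightarrow> \<bar>f z\<bar> \<le> C) \<longrightarrow> \<bar>\<integral>z. m z * f z \<partial>lborel\<bar> \<le> K * C"
    using bounded_weight_bound[OF m] by (elim exE)
  note bd = KR[rule_format]
  let ?P = "real k * bump_avg m (k - 1) t x"
  have "((\<lambda>t. bump_avg m k t x) has_derivative (\<lambda>h. ?P * h)) (at t)"
  \<comment> \<open>Increments shorter than \<open>t\<close> keep \<open>t + h\<close> below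
    \<open>2 * t\<close>, which serves as the common bound \<open>T\<close> of
    \<open>bump_time_taylor\<close>.\<close>
  proof (rule has_derivative_quadratic[OF bounded_linear_mult_right \<open>0 < t\<close>])
    fix h :: real assume h: "norm h < t"
    have "bump_avg m k (t + h) x - bump_avg m k t x - ?P * h
      = (\<integral>z. m z * bump k (t + h) (z - x) \<partial>lborel) - (\<integral>z. m z * bump k t (z - x) \<partial>lborel)
        - (real k * h) * (\<integral>z. m z * bump (k - 1) t (z - x) \<partial>lborel)"
      by (simp add: bump_avg_def)
    also have "\<dots> = (\<integral>z. m z * bump k (t + h) (z - x) - m z * bump k t (z - x)
         - (real k * h) * (m z * bump (k - 1) t (z - x)) \<partial>lborel)"
      by (rule integral_diff_diff_cmult) (intro int continuous_intros)+
    also have "\<dots> = (\<integral>z. m z * (bump k (t + h) (z - x) - bump k t (z - x)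
         - real k * bump (k - 1) t (z - x) * (t + h - t)) \<partial>lborel)"
      by (intro Bochner_Integration.integral_cong) (auto simp: algebra_simps)
    finally have eq: "bump_avg m k (t + h) x - bump_avg m k t x - ?P * h = \<dots>" .
    have "\<bar>\<dots>\<bar> \<le> K * ((real k gchoose 2) * (2 * t) ^ (k - 2) * (t + h - t)\<^sup>2)"
      by (rule bd, intro continuous_intros, rule bump_time_taylor) (use assms h in auto)
    then show "norm (bump_avg m k (t + h) x - bump_avg m k t x - ?P * h)
        \<le> (K * ((real k gchoose 2) * (2 * t) ^ (k - 2))) * (norm h)\<^sup>2"
      unfolding eq by (simp add: mult.assoc)
  qed
  then show ?thesis by (simp add: has_field_derivative_def)
qed

lemma linear_bump_grad:
  assumes m: "bounded_weight m"
  shows "linear (bump_grad m k t x)"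
proof -
  note int = bounded_weight_integrable[OF m]
  show ?thesis
  proof
    fix g h
    have "(\<integral>z. m z * (((z - x) \<bullet> (g + h)) * bump (k - 1) t (z - x)) \<partial>lborel)
       = (\<integral>z. m z * (((z - x) \<bullet> g) * bump (k - 1) t (z - x)) + m z * (((z - x) \<bullet> h) * bump (k - 1) t (z - x)) \<partial>lborel)"
      by (intro Bochner_Integration.integral_cong) (auto simp: inner_add_right algebra_simps)
    also have "\<dots> = (\<integral>z. m z * (((z - x) \<bullet> g) * bump (k - 1) t (z - x)) \<partial>lborel)
        + (\<integral>z. m z * (((z - x) \<bullet> h) * bump (k - 1) t (z - x)) \<partial>lborel)"
      by (intro Bochner_Integration.integral_add int continuous_intros)
    finally show "bump_grad m k t x (g + h) = bump_grad m k t x g + bump_grad m k t x h"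
      by (simp add: bump_grad_def distrib_left)
  next
    fix c h
    have "(\<integral>z. m z * (((z - x) \<bullet> (c *\<^sub>R h)) * bump (k - 1) t (z - x)) \<partial>lborel)
       = (\<integral>z. c * (m z * (((z - x) \<bullet> h) * bump (k - 1) t (z - x))) \<partial>lborel)"
      by (intro Bochner_Integration.integral_cong) (auto simp: mult_ac)
    then show "bump_grad m k t x (c *\<^sub>R h) = c *\<^sub>R bump_grad m k t x h"
      by (simp add: bump_grad_def mult_ac)
  qed
qed

lemma bump_avg_has_derivative:
  assumes m: "bounded_weight m" and "3 \<le> k" "0 \<le> t"
  shows "(bump_avg m k t has_derivative bump_grad m k t x) (at x)"
proof -
  note int = bounded_weight_integrable[OF m]
  obtain K R where KR: "\<forall>f C. continuous_on UNIV f \<longrightarrow>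
      (\<forall>z. norm z \<le> R \<longrightarrow> \<bar>f z\<bar> \<le> C) \<longrightarrow> \<bar>\<integral>z. m z * f z \<partial>lborel\<bar> \<le> K * C"
    using bounded_weight_bound[OF m] by (elim exE)
  note bd = KR[rule_format]
  \<comment> \<open>The constant of \<open>bump_space_taylor1\<close> for the point
    \<open>z - x\<close>, whose norm is at most \<open>R + norm x\<close> when
    \<open>norm z \<le> R\<close>.\<close>
  define C where "C = (real k gchoose 2) * t ^ (k - 2) * (2 * (R + norm x) + 1)\<^sup>2 + real k * t ^ (k - 1)"
  show ?thesis
  proof (rule has_derivative_quadratic[where \<delta> = 1 and K = "K * C"])
    show "bounded_linear (bump_grad m k t x)"
      using linear_bump_grad[OF m] by (simp add: linear_conv_bounded_linear)
  next
    fix h :: 'a assume h: "norm h < 1"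
    have "bump_avg m k t (x + h) - bump_avg m k t x - bump_grad m k t x h
      = (\<integral>z. m z * bump k t (z - (x + h)) \<partial>lborel) - (\<integral>z. m z * bump k t (z - x) \<partial>lborel)
        - (2 * real k) * (\<integral>z. m z * (((z - x) \<bullet> h) * bump (k - 1) t (z - x)) \<partial>lborel)"
      by (simp add: bump_avg_def bump_grad_def)
    also have "\<dots> = (\<integral>z. m z * bump k t (z - (x + h)) - m z * bump k t (z - x)
         - (2 * real k) * (m z * (((z - x) \<bullet> h) * bump (k - 1) t (z - x))) \<partial>lborel)"
      by (rule integral_diff_diff_cmult) (intro int continuous_intros)+
    also have "\<dots> = (\<integral>z. m z * (bump k t (z - x - h) - bump k t (z - x)
         - 2 * real k * ((z - x) \<bullet> h) * bump (k - 1) t (z - x)) \<partial>lborel)"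
      by (intro Bochner_Integration.integral_cong) (auto simp: algebra_simps)
    finally have eq: "bump_avg m k t (x + h) - bump_avg m k t x - bump_grad m k t x h = \<dots>" .
    have "\<bar>\<dots>\<bar> \<le> K * (C * (norm h)\<^sup>2)"
    proof (rule bd, intro continuous_intros)
      fix z :: 'a assume z: "norm z \<le> R"
      show "\<bar>bump k t (z - x - h) - bump k t (z - x)
         - 2 * real k * ((z - x) \<bullet> h) * bump (k - 1) t (z - x)\<bar> \<le> C * (norm h)\<^sup>2"
        unfolding C_def
        by (rule bump_space_taylor1) (use assms z h norm_triangle_ineq4[of z x] in auto)
    qed
    then show "norm (bump_avg m k t (x + h) - bump_avg m k t x - bump_grad m k t x h)
        \<le> K * C * (norm h)\<^sup>2"
      unfolding eq by (simp add: mult.assoc)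
  qed simp
qed

text \<open>Splitting \<open>(z - x) \<bullet> h\<close> into
  \<open>z \<bullet> h - x \<bullet> h\<close> expresses the gradient through averages for two
  weights. Differentiating once more then needs only the product rule and no new estimate.\<close>

lemma bump_grad_eq:
  assumes m: "bounded_weight m"
  shows "bump_grad m k t x h
    = 2 * real k * (bump_avg (\<lambda>z. m z * (z \<bullet> h)) (k - 1) t x - (x \<bullet> h) * bump_avg m (k - 1) t x)"
proof -
  have "(\<integral>z. m z * (((z - x) \<bullet> h) * bump (k - 1) t (z - x)) \<partial>lborel)
     = (\<integral>z. m z * (z \<bullet> h) * bump (k - 1) t (z - x) - (x \<bullet> h) * (m z * bump (k - 1) t (z - x)) \<partial>lborel)"
    by (intro Bochner_Integration.integral_cong) (auto simp: algebra_simps)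
  also have "\<dots> = bump_avg (\<lambda>z. m z * (z \<bullet> h)) (k - 1) t x - (x \<bullet> h) * bump_avg m (k - 1) t x"
    unfolding bump_avg_def
    by (subst Bochner_Integration.integral_diff)
       (auto intro!: bounded_weight_integrable m bounded_weight_mult_inner integrable_mult_right continuous_intros)
  finally show ?thesis by (simp add: bump_grad_def)
qed

section \<open>Second derivatives and the Laplacian\<close>

text \<open>The derivative in direction \<open>c\<close> of the right-hand side of
  \<open>bump_grad_eq\<close> with \<open>h = b\<close>, as the product rule delivers it.\<close>

definition bump_hess :: "('a::euclidean_space \<Rightarrow> real) \<Rightarrow> nat \<Rightarrow> real \<Rightarrow> 'a \<Rightarrow> 'a \<Rightarrow> 'a \<Rightarrow> real" where
  "bump_hess m k t b x c = 2 * real k * (bump_grad (\<lambda>z. m z * (z \<bullet> b)) (k - 1) t x c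
     - ((x \<bullet> b) * bump_grad m (k - 1) t x c + (c \<bullet> b) * bump_avg m (k - 1) t x))"

lemma bump_grad_has_derivative:
  assumes m: "bounded_weight m" and "4 \<le> k" "0 \<le> t"
  shows "((\<lambda>x. bump_grad m k t x b) has_derivative bump_hess m k t b x) (at x)"
proof -
  have k: "3 \<le> k - 1" using assms by simp
  show ?thesis
    unfolding bump_grad_eq[OF m, of k t _ b] bump_hess_def
    by (intro has_derivative_mult_right has_derivative_diff has_derivative_mult
        bump_avg_has_derivative m bounded_weight_mult_inner k assms has_derivative_inner_left has_derivative_ident)
qed

lemma continuous_on_bump_avg:
  assumes "bounded_weight m" "3 \<le> k" "0 \<le> t"
  shows "continuous_on S (bump_avg m k t)"
  using has_derivative_continuous_on[OF has_derivative_at_withinI[OF bump_avg_has_derivative[OF assms]]] .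

lemma continuous_on_bump_grad:
  assumes "bounded_weight m" "4 \<le> k" "0 \<le> t"
  shows "continuous_on S (\<lambda>x. bump_grad m k t x h)"
  using has_derivative_continuous_on[OF has_derivative_at_withinI[OF bump_grad_has_derivative[OF assms]]] .

lemma continuous_on_bump_hess:
  assumes "bounded_weight m" "5 \<le> k" "0 \<le> t"
  shows "continuous_on S (\<lambda>x. bump_hess m k t b x c)"
  unfolding bump_hess_def using assms
  by (intro continuous_intros continuous_on_bump_grad continuous_on_bump_avg bounded_weight_mult_inner) auto

text \<open>For \<open>3 \<le> k\<close> this is the classical Laplacian of \<open>bump k t\<close>
  at \<open>y\<close>, given in closed form.\<close>

definition bump_laplacian :: "nat \<Rightarrow> real \<Rightarrow> 'a::euclidean_space \<Rightarrow> real" where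
  "bump_laplacian k t y = 4 * real k * (real k - 1) * (y \<bullet> y) * bump (k - 2) t y
     - 2 * real k * real DIM('a) * bump (k - 1) t y"

text \<open>\<open>inner_mult_bump\<close> trades the factor \<open>y \<bullet> y\<close> for
  kernels of neighbouring exponents. The coefficients no longer depend on \<open>y\<close>, so
  integration against a weight gives a relation between two values of
  \<open>bump_avg\<close>.\<close>

lemma bump_laplacian_eq:
  fixes y :: "'a::euclidean_space"
  assumes "3 \<le> k"
  shows "bump_laplacian k t y = 2 * real k *
    (2 * (real k - 1) * t * bump (k - 2) t y - (real DIM('a) + 2 * (real k - 1)) * bump (k - 1) t y)"
proof -
  have "Suc (k - 2) = k - 1" using assms by simp
  then have "(y \<bullet> y) * bump (k - 2) t y = t * bump (k - 2) t y - bump (k - 1) t y"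
    using inner_mult_bump[of "k - 2" y t] assms by simp
  then have "bump_laplacian k t y = 4 * real k * (real k - 1) * (t * bump (k - 2) t y - bump (k - 1) t y)
     - 2 * real k * real DIM('a) * bump (k - 1) t y"
    by (simp add: bump_laplacian_def mult.assoc)
  then show ?thesis by (simp add: algebra_simps)
qed

text \<open>In each diagonal entry the terms with \<open>z \<bullet> b\<close> and
  \<open>x \<bullet> b\<close> recombine to \<open>((z - x) \<bullet> b)\<^sup>2\<close>. Summing
  over the basis gives the squared norm of \<open>z - x\<close>, and the constant terms contribute
  the dimension.\<close>

lemma sum_bump_hess:
  fixes m :: "'a::euclidean_space \<Rightarrow> real"
  assumes m: "bounded_weight m" and "2 \<le> k"
  shows "(\<Sum>b\<in>Basis. bump_hess m k t b x b) = (\<integral>z. m z * bump_laplacian k t (z - x) \<partial>lborel)"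
proof -
  note int = bounded_weight_integrable[OF m]
  let ?g = "\<lambda>z. bump (k - 2) t (z - x)" and ?f = "\<lambda>z. bump (k - 1) t (z - x)"
  have "bump_hess m k t b x b =
     (\<integral>z. m z * (4 * real k * (real k - 1) * ((z - x) \<bullet> b)\<^sup>2 * ?g z - 2 * real k * ?f z) \<partial>lborel)"
    if b: "b \<in> Basis" for b
  proof -
    let ?A = "\<integral>z. m z * (z \<bullet> b) * (((z - x) \<bullet> b) * ?g z) \<partial>lborel"
    let ?B = "\<integral>z. m z * (((z - x) \<bullet> b) * ?g z) \<partial>lborel"
    let ?C = "\<integral>z. m z * ?f z \<partial>lborel"
    have k: "k - 1 - 1 = k - 2" "real (k - 1) = real k - 1" using assms by auto
    have "bump_hess m k t b x b = 2 * real k * (2 * (real k - 1) * ?A - ((x \<bullet> b) * (2 * (real k - 1) * ?B) + ?C))"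
      using b unfolding bump_hess_def bump_grad_def bump_avg_def k by simp
    also have "\<dots> = (4 * real k * (real k - 1)) * ?A - (4 * real k * (real k - 1) * (x \<bullet> b)) * ?B - (2 * real k) * ?C"
      by (simp add: algebra_simps)
    also have "\<dots> = (\<integral>z. (4 * real k * (real k - 1)) * (m z * (z \<bullet> b) * (((z - x) \<bullet> b) * ?g z))
        - (4 * real k * (real k - 1) * (x \<bullet> b)) * (m z * (((z - x) \<bullet> b) * ?g z))
        - (2 * real k) * (m z * ?f z) \<partial>lborel)"
      using int[of "\<lambda>z. ((z - x) \<bullet> b) * ?g z"] int[of ?f]
        bounded_weight_integrable[OF bounded_weight_mult_inner[OF m], of "\<lambda>z. ((z - x) \<bullet> b) * ?g z" b]
      by (simp add: continuous_intros)
    also have "\<dots> = (\<integral>z. m z * (4 * real k * (real k - 1) * ((z - x) \<bullet> b)\<^sup>2 * ?g z - 2 * real k * ?f z) \<partial>lborel)"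
      by (intro Bochner_Integration.integral_cong) (auto simp: algebra_simps power2_eq_square)
    finally show ?thesis .
  qed
  then have "(\<Sum>b\<in>Basis. bump_hess m k t b x b) = (\<Sum>b\<in>Basis. 
     (\<integral>z. m z * (4 * real k * (real k - 1) * ((z - x) \<bullet> b)\<^sup>2 * ?g z - 2 * real k * ?f z) \<partial>lborel))"
    by simp
  also have "\<dots> = (\<integral>z. (\<Sum>b\<in>Basis. m z * (4 * real k * (real k - 1) * ((z - x) \<bullet> b)\<^sup>2 * ?g z - 2 * real k * ?f z)) \<partial>lborel)"
    by (intro Bochner_Integration.integral_sum[symmetric] int continuous_intros)
  also have "\<dots> = (\<integral>z. m z * bump_laplacian k t (z - x) \<partial>lborel)"
  proof (intro Bochner_Integration.integral_cong refl)
    fix z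
    have "(\<Sum>b\<in>Basis. ((z - x) \<bullet> b)\<^sup>2) = (z - x) \<bullet> (z - x)"
      by (subst euclidean_inner) (simp add: power2_eq_square)
    then show "(\<Sum>b\<in>Basis. m z * (4 * real k * (real k - 1) * ((z - x) \<bullet> b)\<^sup>2 * ?g z - 2 * real k * ?f z))
        = m z * bump_laplacian k t (z - x)"
      by (simp add: bump_laplacian_def sum_distrib_left[symmetric] sum_distrib_right[symmetric] sum_subtractf)
  qed
  finally show ?thesis .
qed

section \<open>Moments of the uniform distribution on the ball\<close>

lemma sets_ball_space [simp, measurable_cong]: "sets ball_space = sets borel"
  by (simp add: ball_space_def)

lemma space_ball_space [simp]: "space ball_space = UNIV"
  by (simp add: ball_space_def)

lemma emeasure_unit_ball:
  "emeasure lborel (ball (0::'a::euclidean_space) 1) \<noteq> 0"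
  "emeasure lborel (ball (0::'a::euclidean_space) 1) < \<infinity>"
proof -
  show "emeasure lborel (ball (0::'a) 1) < \<infinity>" using emeasure_lborel_ball_finite[of 0 1] by simp
  show "emeasure lborel (ball (0::'a) 1) \<noteq> 0"
    using content_ball_pos[of 1 "0::'a"] by (auto simp: measure_def)
qed

lemma prob_space_ball_space: "prob_space (ball_space :: 'a::euclidean_space measure)"
  unfolding ball_space_def using emeasure_unit_ball[where 'a='a]
  by (intro prob_space_uniform_measure) auto

lemma AE_ball_space:
  "(AE w in ball_space. P w) \<longleftrightarrow> (AE w in lborel. norm (w::'a::euclidean_space) < 1 \<longrightarrow> P w)"
  unfolding ball_space_def using AE_uniform_measure[OF emeasure_unit_ball[where 'a='a]] by simp

lemma AE_ball_space_norm: "AE w in ball_space. norm (w::'a::euclidean_space) < 1"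
  by (simp add: AE_ball_space)

lemma integrable_ball_space_continuous:
  fixes f :: "'a::euclidean_space \<Rightarrow> real"
  assumes "continuous_on UNIV f"
  shows "integrable ball_space f"
proof -
  interpret prob_space "ball_space :: 'a measure" by (rule prob_space_ball_space)
  have "bounded (f ` cball 0 1)"
    using assms by (intro compact_imp_bounded compact_continuous_image)
      (auto intro: continuous_on_subset)
  then obtain B where B: "\<And>w. norm w \<le> 1 \<Longrightarrow> norm (f w) \<le> B"
    unfolding bounded_iff by (metis image_eqI mem_cball_0)
  have [measurable]: "f \<in> borel_measurable borel" using assms by (rule borel_measurable_continuous_onI)
  show ?thesis
    by (rule integrable_const_bound[of _ B]) (use AE_ball_space_norm B in \<open>auto elim!: eventually_mono\<close>)
qed

section \<open>Symmetries of the ball: sign changes and coordinate swaps\<close>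

lemma distr_ball_space:
  fixes T :: "'a::euclidean_space \<Rightarrow> 'a"
  assumes [measurable]: "T \<in> borel_measurable borel" and T: "distr lborel borel T = lborel"
    and norm: "\<And>w. norm (T w) = norm w"
  shows "distr ball_space borel T = ball_space"
proof (rule measure_eqI)
  fix A assume "A \<in> sets (distr (ball_space :: 'a measure) borel T)"
  then have [measurable]: "A \<in> sets borel" by simp
  have [measurable]: "T -` A \<in> sets borel" using measurable_sets[OF assms(1), of A] by simp
  have "emeasure lborel (ball 0 1 \<inter> A) = emeasure (distr lborel borel T) (ball 0 1 \<inter> A)"
    by (simp add: T)
  also have "\<dots> = emeasure lborel (T -` (ball 0 1 \<inter> A))"
    by (subst emeasure_distr) auto
  also have "T -` (ball 0 1 \<inter> A) = ball 0 1 \<inter> T -` A" by (auto simp: norm)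
  finally show "emeasure (distr ball_space borel T) A = emeasure ball_space A"
    by (subst emeasure_distr) (auto simp: ball_space_def)
qed simp

lemma integral_ball_space_distr:
  fixes T :: "'a::euclidean_space \<Rightarrow> 'a" and f :: "'a \<Rightarrow> real"
  assumes [measurable]: "T \<in> borel_measurable borel" "f \<in> borel_measurable borel"
    and T: "distr lborel borel T = lborel" and norm: "\<And>w. norm (T w) = norm w"
  shows "(\<integral>w. f (T w) \<partial>ball_space) = (\<integral>w. f w \<partial>ball_space)"
proof -
  have "(\<integral>w. f w \<partial>ball_space) = (\<integral>w. f w \<partial>distr ball_space borel T)"
    using assms by (simp add: distr_ball_space)
  also have "\<dots> = (\<integral>w. f (T w) \<partial>ball_space)" by (rule integral_distr) auto
  finally show ?thesis by simp
qed

lemma distr_lborel_sign_change: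
  fixes c :: "'a::euclidean_space \<Rightarrow> real"
  assumes "\<And>j. j \<in> Basis \<Longrightarrow> \<bar>c j\<bar> = 1"
  shows "distr lborel borel (\<lambda>x. \<Sum>j\<in>Basis. (c j * (x \<bullet> j)) *\<^sub>R j) = lborel"
proof -
  have "c j \<noteq> 0" if "j \<in> Basis" for j using assms[OF that] by auto
  then show ?thesis
    using lborel_affine_euclidean[of c 0] assms by (simp add: density_1)
qed

lemma norm_sign_change:
  fixes c :: "'a::euclidean_space \<Rightarrow> real"
  assumes "\<And>j. j \<in> Basis \<Longrightarrow> \<bar>c j\<bar> = 1"
  shows "norm (\<Sum>j\<in>Basis. (c j * (x \<bullet> j)) *\<^sub>R j) = norm x" (is "norm ?y = _")
proof -
  have "(c j * (x \<bullet> j))\<^sup>2 = (x \<bullet> j)\<^sup>2" if "j \<in> Basis" for j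
    using assms[OF that] by (metis abs_1 abs_mult mult_1 power2_abs)
  then have "(\<Sum>j\<in>Basis. (c j * (x \<bullet> j)) * (c j * (x \<bullet> j))) = (\<Sum>j\<in>Basis. (x \<bullet> j) * (x \<bullet> j))"
    unfolding power2_eq_square by (intro sum.cong refl) auto
  also have "\<dots> = x \<bullet> x" by (rule euclidean_inner[symmetric])
  moreover have "?y \<bullet> ?y = (\<Sum>j\<in>Basis. (?y \<bullet> j) * (?y \<bullet> j))" by (rule euclidean_inner)
  moreover have "?y \<bullet> j = c j * (x \<bullet> j)" if "j \<in> Basis" for j using that by simp
  ultimately have "?y \<bullet> ?y = x \<bullet> x" by simp
  then show ?thesis by (simp only: norm_eq_sqrt_inner)
qed

lemma integral_ball_space_sign_change:
  fixes f :: "'a::euclidean_space \<Rightarrow> real"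
  assumes "\<And>j. j \<in> Basis \<Longrightarrow> \<bar>c j\<bar> = 1" "f \<in> borel_measurable borel"
  shows "(\<integral>w. f (\<Sum>j\<in>Basis. (c j * (w \<bullet> j)) *\<^sub>R j) \<partial>ball_space) = (\<integral>w. f w \<partial>ball_space)"
  by (rule integral_ball_space_distr)
     (use assms in \<open>auto intro!: distr_lborel_sign_change norm_sign_change\<close>)

definition swap_coords :: "'a::euclidean_space \<Rightarrow> 'a \<Rightarrow> 'a \<Rightarrow> 'a" where
  "swap_coords b c x = (\<Sum>j\<in>Basis. (x \<bullet> Transposition.transpose b c j) *\<^sub>R j)"

lemma transpose_Basis [simp]:
  "b \<in> Basis \<Longrightarrow> c \<in> Basis \<Longrightarrow> Transposition.transpose b c j \<in> Basis \<longleftrightarrow> j \<in> Basis"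
  by (auto simp: Transposition.transpose_def)

lemma inner_swap_coords:
  "j \<in> Basis \<Longrightarrow> swap_coords b c x \<bullet> j = x \<bullet> Transposition.transpose b c j"
  by (simp add: swap_coords_def)

lemma bij_betw_transpose_Basis:
  "b \<in> Basis \<Longrightarrow> c \<in> Basis \<Longrightarrow> bij_betw (Transposition.transpose b c) (Basis::'a::euclidean_space set) Basis"
  by (rule bij_betw_byWitness[where f' = "Transposition.transpose b c"]) auto

lemma measurable_swap_coords [measurable]: "swap_coords b c \<in> borel_measurable borel"
  unfolding swap_coords_def[abs_def] by measurable

text \<open>Lebesgue measure is determined by its values on boxes. The preimage of a box is the box
  with swapped corners, whose side lengths are the same ones in another order.\<close>

lemma distr_lborel_swap_coords:
  fixes b c :: "'a::euclidean_space"
  assumes bc: "b \<in> Basis" "c \<in> Basis"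
  shows "distr lborel borel (swap_coords b c) = lborel"
proof (rule lborel_eqI[symmetric])
  fix l u :: 'a assume lu: "\<And>i. i \<in> Basis \<Longrightarrow> l \<bullet> i \<le> u \<bullet> i"
  let ?t = "Transposition.transpose b c"
  have all: "(\<forall>i\<in>Basis. P i) \<longleftrightarrow> (\<forall>i\<in>Basis. P (?t i))" for P
    using bij_betw_transpose_Basis[OF bc] by (metis bc transpose_Basis transpose_involutory)
  have "swap_coords b c -` box l u = box (swap_coords b c l) (swap_coords b c u)"
  proof (intro set_eqI)
    fix x
    have "x \<in> swap_coords b c -` box l u \<longleftrightarrow> (\<forall>i\<in>Basis. l \<bullet> i < x \<bullet> ?t i \<and> x \<bullet> ?t i < u \<bullet> i)"
      by (auto simp: box_def inner_swap_coords)
    also have "\<dots> \<longleftrightarrow> (\<forall>i\<in>Basis. l \<bullet> ?t i < x \<bullet> i \<and> x \<bullet> i < u \<bullet> ?t i)"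
      by (subst all) simp
    finally show "x \<in> swap_coords b c -` box l u \<longleftrightarrow> x \<in> box (swap_coords b c l) (swap_coords b c u)"
      by (simp add: box_def inner_swap_coords)
  qed
  then have "emeasure (distr lborel borel (swap_coords b c)) (box l u)
      = emeasure lborel (box (swap_coords b c l) (swap_coords b c u))"
    by (subst emeasure_distr) auto
  also have "\<dots> = (\<Prod>i\<in>Basis. (swap_coords b c u - swap_coords b c l) \<bullet> i)"
    using lu bc by (intro emeasure_lborel_box) (auto simp: inner_swap_coords)
  also have "(\<Prod>i\<in>Basis. (swap_coords b c u - swap_coords b c l) \<bullet> i) = (\<Prod>i\<in>Basis. (u - l) \<bullet> ?t i)"
    by (intro prod.cong) (auto simp: inner_swap_coords inner_diff_left)
  also have "\<dots> = (\<Prod>i\<in>Basis. (u - l) \<bullet> i)"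
    by (rule prod.reindex_bij_betw[OF bij_betw_transpose_Basis[OF bc]])
  finally show "emeasure (distr lborel borel (swap_coords b c)) (box l u) = (\<Prod>i\<in>Basis. (u - l) \<bullet> i)" .
qed simp

lemma norm_swap_coords:
  fixes b c :: "'a::euclidean_space"
  assumes bc: "b \<in> Basis" "c \<in> Basis"
  shows "norm (swap_coords b c x) = norm x"
proof -
  have "(\<Sum>i\<in>Basis. (x \<bullet> Transposition.transpose b c i) * (x \<bullet> Transposition.transpose b c i))
      = (\<Sum>i\<in>Basis. (x \<bullet> i) * (x \<bullet> i))"
    by (rule sum.reindex_bij_betw[OF bij_betw_transpose_Basis[OF bc]])
  then show ?thesis
    by (subst (1 2) norm_eq_sqrt_inner, subst (1 2) euclidean_inner) (simp add: inner_swap_coords)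
qed

section \<open>First and second moments\<close>

text \<open>The common second moment of the coordinates, written as their mean. The dummy argument
  carries the space and thereby the dimension.\<close>

definition ball_moment :: "'a::euclidean_space itself \<Rightarrow> real" where
  "ball_moment _ = (\<integral>w. (w::'a) \<bullet> w \<partial>ball_space) / real DIM('a)"

text \<open>The reflection \<open>w \<mapsto> - w\<close>, a sign change in all coordinates,
  reverses the sign of the integrand.\<close>

lemma integral_ball_space_inner: "(\<integral>w. y \<bullet> w \<partial>ball_space) = 0"
proof -
  have "(\<integral>w. y \<bullet> (\<Sum>j\<in>Basis. ((- 1) * (w \<bullet> j)) *\<^sub>R j) \<partial>ball_space) = (\<integral>w. y \<bullet> w \<partial>ball_space)"
    by (rule integral_ball_space_sign_change) auto
  also have "(\<lambda>w. y \<bullet> (\<Sum>j\<in>Basis. ((- 1) * (w \<bullet> j)) *\<^sub>R j)) = (\<lambda>w. - (y \<bullet> w))"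
    by (simp add: sum_negf euclidean_representation)
  finally show ?thesis by simp
qed

text \<open>Flipping the sign of the coordinate \<open>b\<close> alone reverses the sign of the
  product.\<close>

lemma integral_ball_space_coord_mult:
  fixes b c :: "'a::euclidean_space"
  assumes bc: "b \<in> Basis" "c \<in> Basis" "b \<noteq> c"
  shows "(\<integral>w. (w \<bullet> b) * (w \<bullet> c) \<partial>ball_space) = 0"
proof -
  let ?s = "\<lambda>j. if j = b then - 1 else 1 :: real"
  let ?T = "\<lambda>w. \<Sum>j\<in>Basis. (?s j * (w \<bullet> j)) *\<^sub>R j"
  have "(\<integral>w. (?T w \<bullet> b) * (?T w \<bullet> c) \<partial>ball_space) = (\<integral>w. (w \<bullet> b) * (w \<bullet> c) \<partial>ball_space)"
    by (rule integral_ball_space_sign_change[where f = "\<lambda>w. (w \<bullet> b) * (w \<bullet> c)"]) auto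
  moreover have "?T w \<bullet> j = ?s j * (w \<bullet> j)" if "j \<in> Basis" for w j
    using that by simp
  ultimately show ?thesis using bc by simp
qed

text \<open>Swapping coordinates shows that all of them have the same second moment, and these
  moments add up to the integral of \<open>w \<bullet> w\<close>.\<close>

lemma integral_ball_space_coord_square:
  fixes b :: "'a::euclidean_space"
  assumes b: "b \<in> Basis"
  shows "(\<integral>w. (w \<bullet> b)\<^sup>2 \<partial>ball_space) = ball_moment TYPE('a)"
proof -
  have eq: "(\<integral>w. (w \<bullet> c)\<^sup>2 \<partial>ball_space) = (\<integral>w. (w \<bullet> b)\<^sup>2 \<partial>ball_space)" if c: "c \<in> Basis" for c :: 'a
  proof -
    have "(\<integral>w. (swap_coords b c w \<bullet> b)\<^sup>2 \<partial>ball_space) = (\<integral>w. (w \<bullet> b)\<^sup>2 \<partial>ball_space)"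
      by (rule integral_ball_space_distr[where f = "\<lambda>w. (w \<bullet> b)\<^sup>2"])
         (use b c in \<open>auto simp: distr_lborel_swap_coords norm_swap_coords\<close>)
    then show ?thesis using b by (simp add: inner_swap_coords)
  qed
  have "(\<integral>w. (w::'a) \<bullet> w \<partial>ball_space) = (\<integral>w. (\<Sum>c\<in>Basis. ((w::'a) \<bullet> c)\<^sup>2) \<partial>ball_space)"
    by (subst euclidean_inner) (simp add: power2_eq_square)
  also have "\<dots> = (\<Sum>c\<in>Basis. (\<integral>w. ((w::'a) \<bullet> c)\<^sup>2 \<partial>ball_space))"
    by (intro Bochner_Integration.integral_sum integrable_ball_space_continuous continuous_intros)
  also have "\<dots> = real DIM('a) * (\<integral>w. (w \<bullet> b)\<^sup>2 \<partial>ball_space)"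
    using eq by simp
  finally show ?thesis by (simp add: ball_moment_def)
qed

lemma integral_ball_space_inner_self:
  "(\<integral>w. (w::'a::euclidean_space) \<bullet> w \<partial>ball_space) = real DIM('a) * ball_moment TYPE('a)"
  by (simp add: ball_moment_def)

lemma integral_ball_space_inner_square:
  fixes y :: "'a::euclidean_space"
  shows "(\<integral>w. (y \<bullet> w)\<^sup>2 \<partial>ball_space) = ball_moment TYPE('a) * (y \<bullet> y)"
proof -
  have "(y \<bullet> w)\<^sup>2 = (\<Sum>b\<in>Basis. \<Sum>c\<in>Basis. (y \<bullet> b) * (y \<bullet> c) * ((w \<bullet> b) * (w \<bullet> c)))" for w
    by (subst euclidean_inner) (simp add: power2_eq_square sum_product mult_ac)
  then have "(\<integral>w. (y \<bullet> w)\<^sup>2 \<partial>ball_space)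
      = (\<integral>w. (\<Sum>b\<in>Basis. \<Sum>c\<in>Basis. (y \<bullet> b) * (y \<bullet> c) * ((w \<bullet> b) * (w \<bullet> c))) \<partial>ball_space)"
    by simp
  also have "\<dots> = (\<Sum>b\<in>Basis. \<integral>w. (\<Sum>c\<in>Basis. (y \<bullet> b) * (y \<bullet> c) * ((w \<bullet> b) * (w \<bullet> c))) \<partial>ball_space)"
    by (intro Bochner_Integration.integral_sum integrable_ball_space_continuous continuous_intros)
  also have "\<dots> = (\<Sum>b\<in>Basis. \<Sum>c\<in>Basis. \<integral>w. (y \<bullet> b) * (y \<bullet> c) * ((w \<bullet> b) * (w \<bullet> c)) \<partial>ball_space)"
    by (intro sum.cong refl Bochner_Integration.integral_sum integrable_ball_space_continuous continuous_intros)
  also have "\<dots> = (\<Sum>b\<in>Basis. \<Sum>c\<in>Basis. if c = b then (y \<bullet> b)\<^sup>2 * ball_moment TYPE('a) else 0)"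
  proof (intro sum.cong refl)
    fix b c :: 'a assume bc: "b \<in> Basis" "c \<in> Basis"
    show "(\<integral>w. (y \<bullet> b) * (y \<bullet> c) * ((w \<bullet> b) * (w \<bullet> c)) \<partial>ball_space)
        = (if c = b then (y \<bullet> b)\<^sup>2 * ball_moment TYPE('a) else 0)"
    proof (cases "c = b")
      case True
      then show ?thesis
        using integral_ball_space_coord_square[OF bc(1)] by (simp flip: power2_eq_square)
    next
      case False
      then show ?thesis
        using integral_ball_space_coord_mult[OF bc] by auto
    qed
  qed
  also have "\<dots> = (\<Sum>b\<in>Basis. (y \<bullet> b)\<^sup>2) * ball_moment TYPE('a)"
    by (simp add: sum_distrib_right)
  also have "(\<Sum>b\<in>Basis. (y \<bullet> b)\<^sup>2) = y \<bullet> y"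
    by (subst (2) euclidean_inner) (simp add: power2_eq_square)
  finally show ?thesis by (simp add: mult.commute)
qed

text \<open>If the moment vanished, almost every point of the unit ball would be the origin, and the
  ball would be a null set.\<close>

lemma ball_moment_pos: "0 < ball_moment TYPE('a::euclidean_space)"
proof -
  have int: "integrable ball_space (\<lambda>w::'a. w \<bullet> w)"
    by (intro integrable_ball_space_continuous continuous_intros)
  have "(\<integral>w. (w::'a) \<bullet> w \<partial>ball_space) \<noteq> 0"
  proof
    assume "(\<integral>w. (w::'a) \<bullet> w \<partial>ball_space) = 0"
    then have "AE w::'a in ball_space. w \<bullet> w = 0"
      using integral_nonneg_eq_0_iff_AE[OF int] by simp
    then have "AE w::'a in lborel. w \<noteq> 0 \<longrightarrow> w \<notin> ball 0 1"
      unfolding AE_ball_space by (auto elim!: eventually_mono)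
    moreover have "AE w::'a in lborel. w \<noteq> 0" by (rule AE_lborel_singleton)
    ultimately have "AE w::'a in lborel. w \<notin> ball 0 1" by eventually_elim auto
    then have "emeasure lborel (ball (0::'a) 1) = 0"
      by (subst (asm) AE_iff_measurable[where N = "ball 0 1"]) auto
    then show False using emeasure_unit_ball by blast
  qed
  moreover have "(\<integral>w. (w::'a) \<bullet> w \<partial>ball_space) \<ge> 0" by simp
  ultimately have "(\<integral>w. (w::'a) \<bullet> w \<partial>ball_space) > 0" by linarith
  then show ?thesis by (simp add: ball_moment_def)
qed

section \<open>Limits of functions with the small-ball mean value property\<close>

lemma continuous_on_bump_laplacian [continuous_intros]:
  "continuous_on S f \<Longrightarrow> continuous_on S (\<lambda>z. bump_laplacian k t (f z))"
  unfolding bump_laplacian_def by (intro continuous_intros)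

lemma bump_laplacian_eq_0:
  "3 \<le> k \<Longrightarrow> t \<le> R\<^sup>2 \<Longrightarrow> 0 \<le> R \<Longrightarrow> R \<le> norm y \<Longrightarrow> bump_laplacian k t y = 0"
  by (simp add: bump_laplacian_def bump_eq_0)

lemma borel_measurable_bump_laplacian [measurable]: "bump_laplacian k t \<in> borel_measurable borel"
  unfolding bump_laplacian_def[abs_def] by measurable

text \<open>Integrate the expansion of \<open>bump_space_taylor2\<close> with
  \<open>h = \<epsilon> *\<^sub>R w\<close>. The linear term has mean 0, the quadratic ones combine
  to the Laplacian by the second moments, and the remainder is of order
  \<open>\<epsilon> ^ 3\<close>.\<close>

lemma ball_average_bump:
  fixes t :: real
  assumes k: "4 \<le> k" and t: "0 \<le> t"
  shows "\<exists>C. \<forall>y::'a::euclidean_space. \<forall>\<epsilon>. 0 \<le> \<epsilon> \<longrightarrow> \<epsilon> \<le> 1 \<longrightarrow>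
    \<bar>(\<integral>w. bump k t (y - \<epsilon> *\<^sub>R w) \<partial>ball_space) - bump k t y
       - \<epsilon>\<^sup>2 * (ball_moment TYPE('a) / 2) * bump_laplacian k t y\<bar>
     \<le> C * \<epsilon> ^ 3 * indicator (cball 0 (sqrt t + 1)) y"
proof -
  interpret prob_space "ball_space :: 'a measure" by (rule prob_space_ball_space)
  \<comment> \<open>The kernel vanishes beyond \<open>sqrt t\<close>; the extra 1 covers the shifts
    by \<open>\<epsilon> *\<^sub>R w\<close>.\<close>
  define R where "R = sqrt t + 1"
  obtain C where C0: "0 \<le> C" and C: "\<And>y h::'a. norm y \<le> R \<Longrightarrow> norm h \<le> 1 \<Longrightarrow>
      \<bar>bump k t (y - h) - bump k t y - 2 * real k * (y \<bullet> h) * bump (k - 1) t y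
        + real k * (h \<bullet> h) * bump (k - 1) t y
        - 2 * real k * (real k - 1) * (y \<bullet> h)\<^sup>2 * bump (k - 2) t y\<bar> \<le> C * norm h ^ 3"
    using bump_space_taylor2[OF k t, of R] by blast
  show ?thesis
  proof (intro exI allI impI)
    fix y :: 'a and \<epsilon> :: real assume \<epsilon>: "0 \<le> \<epsilon>" "\<epsilon> \<le> 1"
    let ?b1 = "bump (k - 1) t y" and ?b2 = "bump (k - 2) t y"
    let ?A = "\<integral>w. bump k t (y - \<epsilon> *\<^sub>R w) \<partial>ball_space"
    show "\<bar>?A - bump k t y - \<epsilon>\<^sup>2 * (ball_moment TYPE('a) / 2) * bump_laplacian k t y\<bar>
        \<le> C * \<epsilon> ^ 3 * indicator (cball 0 (sqrt t + 1)) y"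
    proof (cases "norm y \<le> R")
      case True
      define E where "E w = bump k t (y - \<epsilon> *\<^sub>R w) - bump k t y - (2 * real k * \<epsilon> * ?b1) * (y \<bullet> w)
         + (real k * \<epsilon>\<^sup>2 * ?b1) * (w \<bullet> w) - (2 * real k * (real k - 1) * \<epsilon>\<^sup>2 * ?b2) * (y \<bullet> w)\<^sup>2" for w
      have i: "integrable ball_space (\<lambda>w. bump k t (y - \<epsilon> *\<^sub>R w))" "integrable ball_space (\<lambda>w. y \<bullet> w)"
        "integrable ball_space (\<lambda>w::'a. w \<bullet> w)" "integrable ball_space (\<lambda>w. (y \<bullet> w)\<^sup>2)"
        by (intro integrable_ball_space_continuous continuous_intros)+
      have "(\<integral>w. E w \<partial>ball_space) = ?A - bump k t y - (2 * real k * \<epsilon> * ?b1) * (\<integral>w. y \<bullet> w \<partial>ball_space)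
         + (real k * \<epsilon>\<^sup>2 * ?b1) * (\<integral>w. (w::'a) \<bullet> w \<partial>ball_space)
         - (2 * real k * (real k - 1) * \<epsilon>\<^sup>2 * ?b2) * (\<integral>w. (y \<bullet> w)\<^sup>2 \<partial>ball_space)"
        unfolding E_def using i prob_space by simp
      also have "\<dots> = ?A - bump k t y - \<epsilon>\<^sup>2 * (ball_moment TYPE('a) / 2) * bump_laplacian k t y"
        unfolding integral_ball_space_inner integral_ball_space_inner_self integral_ball_space_inner_square
          bump_laplacian_def by (simp add: field_simps)
      finally have eq: "(\<integral>w. E w \<partial>ball_space) = \<dots>" .
      have E: "\<bar>E w\<bar> \<le> C * \<epsilon> ^ 3" if w: "norm w < 1" for w
      proof -
        have n: "norm (\<epsilon> *\<^sub>R w) \<le> \<epsilon>"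
          using w \<epsilon> mult_left_mono[of "norm w" 1 \<epsilon>] by simp
        have "\<bar>E w\<bar> \<le> C * norm (\<epsilon> *\<^sub>R w) ^ 3"
          using C[OF True, of "\<epsilon> *\<^sub>R w"] n \<epsilon>
          by (simp add: E_def power_mult_distrib power2_eq_square mult_ac)
        also have "\<dots> \<le> C * \<epsilon> ^ 3" using n C0 by (intro mult_left_mono power_mono) auto
        finally show ?thesis .
      qed
      have iE: "integrable ball_space E" unfolding E_def
        by (intro integrable_ball_space_continuous continuous_intros)
      have "norm (\<integral>w. E w \<partial>ball_space) \<le> (\<integral>w. norm (E w) \<partial>ball_space)"
        by (rule integral_norm_bound)
      also have "\<dots> \<le> (\<integral>w. C * \<epsilon> ^ 3 \<partial>(ball_space :: 'a measure))"
        by (rule integral_mono_AE) (use iE AE_ball_space_norm E in \<open>auto elim!: eventually_mono\<close>)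
      finally show ?thesis using True prob_space unfolding eq by (simp add: R_def)
    next
      case False
      have far: "bump k t (y - \<epsilon> *\<^sub>R w) = 0" if "norm w < 1" for w
      proof (rule bump_eq_0[where R = "sqrt t"])
        have "norm (\<epsilon> *\<^sub>R w) \<le> 1" using that \<epsilon> mult_mono[of \<epsilon> 1 "norm w" 1] by simp
        then show "sqrt t \<le> norm (y - \<epsilon> *\<^sub>R w)"
          using False norm_triangle_ineq2[of y "\<epsilon> *\<^sub>R w"] by (simp add: R_def)
      qed (use t k in auto)
      have "?A = 0"
        by (rule integral_eq_zero_AE) (use AE_ball_space_norm far in \<open>auto elim!: eventually_mono\<close>)
      moreover have "bump k t y = 0" "bump_laplacian k t y = 0"
        using False t k by (auto intro!: bump_eq_0[where R = "sqrt t"] bump_laplacian_eq_0[where R = "sqrt t"] simp: R_def)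
      ultimately show ?thesis using False by (simp add: R_def)
    qed
  qed
qed

text \<open>The supporting ball may move with \<open>w\<close>, but its volume does not depend on
  the centre. The inner integrals are therefore bounded, hence integrable over the probability
  space.\<close>

lemma integrable_moving_support:
  fixes f :: "'a::euclidean_space \<times> 'b::euclidean_space \<Rightarrow> real"
  assumes [measurable]: "f \<in> borel_measurable (ball_space \<Otimes>\<^sub>M lborel)"
    and f: "\<And>w z. \<bar>f (w, z)\<bar> \<le> C * indicator (cball (a w) R) z" and "0 \<le> R"
  shows "integrable (ball_space \<Otimes>\<^sub>M lborel) f"
proof -
  interpret P: prob_space "ball_space :: 'a measure" by (rule prob_space_ball_space)
  interpret pair_sigma_finite "ball_space :: 'a measure" "lborel :: 'b measure" ..
  have [measurable]: "f \<in> borel_measurable (borel \<Otimes>\<^sub>M borel)"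
    using assms(1) by (simp cong: measurable_cong_sets sets_pair_measure_cong)
  have vol: "measure lborel (cball (a w) R) = measure lborel (cball (0::'b) R)" for w
    using \<open>0 \<le> R\<close> by (simp add: content_cball)
  have int: "integrable lborel (\<lambda>z. f (w, z))" for w
    by (rule integrable_bounded_support(1)[OF _ f]) simp
  have "norm (\<integral>z. norm (f (w, z)) \<partial>lborel) \<le> C * measure lborel (cball (0::'b) R)" for w
    using integrable_bounded_support(2)[of "\<lambda>z. norm (f (w, z))" C "a w" R] f[of w] by (simp add: vol)
  then have "integrable ball_space (\<lambda>w. \<integral>z. norm (f (w, z)) \<partial>lborel)"
    by (intro P.integrable_const_bound[where B = "C * measure lborel (cball (0::'b) R)"] AE_I2) measurable
  then show ?thesis
    by (intro Fubini_integrable) (use int in auto)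
qed

lemma lborel_integral_translate:
  fixes f :: "'a::euclidean_space \<Rightarrow> real"
  assumes [measurable]: "f \<in> borel_measurable borel"
  shows "(\<integral>z. f (c + z) \<partial>lborel) = (\<integral>z. f z \<partial>lborel)"
proof -
  have "(\<integral>z. f z \<partial>lborel) = (\<integral>z. f z \<partial>distr lborel borel ((+) c))" by (simp add: lborel_distr_plus)
  also have "\<dots> = (\<integral>z. f (c + z) \<partial>lborel)" by (rule integral_distr) auto
  finally show ?thesis by simp
qed

text \<open>Replace \<open>U z\<close> by its ball average on the support of the kernel, exchange
  the integrals, translate \<open>z\<close> by \<open>\<epsilon> *\<^sub>R w\<close>, and exchange
  them back: the average has moved from \<open>U\<close> to the kernel.\<close>

lemma integral_mean_value_bump:
  fixes U :: "'a::euclidean_space \<Rightarrow> real"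
  assumes [measurable]: "U \<in> borel_measurable borel" and B: "\<And>z. \<bar>U z\<bar> \<le> B"
    and k: "0 < k" and t: "0 \<le> t" and \<epsilon>: "0 \<le> \<epsilon>"
    and mvp: "\<And>z. z \<in> cball x (sqrt t) \<Longrightarrow> U z = (\<integral>w. U (z + \<epsilon> *\<^sub>R w) \<partial>ball_space)"
  shows "(\<integral>z. U z * (\<integral>w. bump k t (z - x - \<epsilon> *\<^sub>R w) \<partial>ball_space) \<partial>lborel)
       = (\<integral>z. U z * bump k t (z - x) \<partial>lborel)"
proof -
  interpret P: prob_space "ball_space :: 'a measure" by (rule prob_space_ball_space)
  interpret pair_sigma_finite "ball_space :: 'a measure" "lborel :: 'a measure" ..
  have B0: "0 \<le> B" using B[of x] abs_ge_zero order_trans by blast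
  have bump_bd: "bump k t y \<le> t ^ k * indicator (cball 0 (sqrt t)) y" for y :: 'a
    using bump_le[OF t, of k y] bump_eq_0[of t "sqrt t" y k] k t by (auto simp: indicator_def)
  have bd: "\<bar>U z' * bump k t y\<bar> \<le> (B * t ^ k) * indicator (cball 0 (sqrt t)) y" for z' y :: 'a
    unfolding abs_mult mult.assoc using bump_bd[of y] bump_nonneg[of k t y] B0 B[of z']
    by (intro mult_mono) auto
  have int1: "integrable (ball_space \<Otimes>\<^sub>M lborel) (\<lambda>(w, z). U (z + \<epsilon> *\<^sub>R w) * bump k t (z - x))"
  proof (rule integrable_moving_support[where a = "\<lambda>_. x" and C = "B * t ^ k" and R = "sqrt t"])
    fix w z :: 'a
    show "\<bar>case (w, z) of (w, z) \<Rightarrow> U (z + \<epsilon> *\<^sub>R w) * bump k t (z - x)\<bar> \<le> B * t ^ k * indicat_real (cball x (sqrt t)) z"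
      using bd[of "z + \<epsilon> *\<^sub>R w" "z - x"] by (auto simp: indicator_def dist_norm norm_minus_commute)
  qed (use t in auto)
  have int2: "integrable (ball_space \<Otimes>\<^sub>M lborel) (\<lambda>(w, z). U z * bump k t (z - x - \<epsilon> *\<^sub>R w))"
  proof (rule integrable_moving_support[where a = "\<lambda>w. x + \<epsilon> *\<^sub>R w" and C = "B * t ^ k" and R = "sqrt t"])
    fix w z :: 'a
    show "\<bar>case (w, z) of (w, z) \<Rightarrow> U z * bump k t (z - x - \<epsilon> *\<^sub>R w)\<bar> \<le> B * t ^ k * indicat_real (cball (x + \<epsilon> *\<^sub>R w) (sqrt t)) z"
      using bd[of "z" "z - x - \<epsilon> *\<^sub>R w"] by (auto simp: indicator_def dist_norm norm_minus_commute diff_diff_eq)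
  qed (use t in auto)
  have "(\<integral>z. U z * bump k t (z - x) \<partial>lborel)
      = (\<integral>z. (\<integral>w. U (z + \<epsilon> *\<^sub>R w) * bump k t (z - x) \<partial>ball_space) \<partial>lborel)"
  proof (intro Bochner_Integration.integral_cong refl)
    fix z
    show "U z * bump k t (z - x) = (\<integral>w. U (z + \<epsilon> *\<^sub>R w) * bump k t (z - x) \<partial>ball_space)"
      using mvp[of z] bump_eq_0[of t "sqrt t" "z - x" k] k t
      by (cases "z \<in> cball x (sqrt t)") (auto simp: dist_norm norm_minus_commute)
  qed
  also have "\<dots> = (\<integral>w. (\<integral>z. U (z + \<epsilon> *\<^sub>R w) * bump k t (z - x) \<partial>lborel) \<partial>ball_space)"
    by (rule Fubini_integral[OF int1])
  also have "\<dots> = (\<integral>w. (\<integral>z. U z * bump k t (z - x - \<epsilon> *\<^sub>R w) \<partial>lborel) \<partial>ball_space)"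
  proof (rule Bochner_Integration.integral_cong[OF refl])
    fix w
    show "(\<integral>z. U (z + \<epsilon> *\<^sub>R w) * bump k t (z - x) \<partial>lborel) = (\<integral>z. U z * bump k t (z - x - \<epsilon> *\<^sub>R w) \<partial>lborel)"
      using lborel_integral_translate[of "\<lambda>z. U z * bump k t (z - x - \<epsilon> *\<^sub>R w)" "\<epsilon> *\<^sub>R w"]
      by (simp add: algebra_simps)
  qed
  also have "\<dots> = (\<integral>z. (\<integral>w. U z * bump k t (z - x - \<epsilon> *\<^sub>R w) \<partial>ball_space) \<partial>lborel)"
    by (rule Fubini_integral[OF int2, symmetric])
  finally show ?thesis by simp
qed

text \<open>By \<open>integral_mean_value_bump\<close> the terms of order zero in
  \<open>ball_average_bump\<close> cancel against \<open>U\<close>. What remains is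
  \<open>\<epsilon>\<^sup>2\<close> times the wanted integral, up to
  \<open>O(\<epsilon> ^ 3)\<close>. The constant \<open>C\<close> is chosen before \<open>U\<close>,
  \<open>B\<close> and \<open>\<epsilon>\<close>, so it serves for a whole sequence.\<close>

lemma mean_value_laplacian_bound:
  fixes x :: "'a::euclidean_space"
  assumes k: "4 \<le> k" and t: "0 \<le> t"
  shows "\<exists>C. \<forall>U B \<epsilon>. U \<in> borel_measurable borel \<longrightarrow> (\<forall>z. \<bar>U z\<bar> \<le> B) \<longrightarrow> 0 < \<epsilon> \<longrightarrow> \<epsilon> \<le> 1 \<longrightarrow>
      (\<forall>z\<in>cball x (sqrt t). U z = (\<integral>w. U (z + \<epsilon> *\<^sub>R w) \<partial>ball_space)) \<longrightarrow>
      \<bar>\<integral>z. U z * bump_laplacian k t (z - x) \<partial>lborel\<bar> \<le> B * C * \<epsilon>"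
proof -
  obtain C where C: "\<And>y::'a. \<And>\<epsilon>. 0 \<le> \<epsilon> \<Longrightarrow> \<epsilon> \<le> 1 \<Longrightarrow>
    \<bar>(\<integral>w. bump k t (y - \<epsilon> *\<^sub>R w) \<partial>ball_space) - bump k t y
       - \<epsilon>\<^sup>2 * (ball_moment TYPE('a) / 2) * bump_laplacian k t y\<bar>
     \<le> C * \<epsilon> ^ 3 * indicator (cball 0 (sqrt t + 1)) y"
    using ball_average_bump[OF k t] by blast
  let ?\<kappa> = "ball_moment TYPE('a) / 2"
  have \<kappa>: "0 < ?\<kappa>" using ball_moment_pos by simp
  let ?V = "measure lborel (cball x (sqrt t + 1))"
  interpret P: prob_space "ball_space :: 'a measure" by (rule prob_space_ball_space)
  show ?thesis
  proof (intro exI allI impI)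
    fix U :: "'a \<Rightarrow> real" and B \<epsilon> :: real
    assume U [measurable]: "U \<in> borel_measurable borel" and B: "\<forall>z. \<bar>U z\<bar> \<le> B" and \<epsilon>: "0 < \<epsilon>" "\<epsilon> \<le> 1"
      and mvp: "\<forall>z\<in>cball x (sqrt t). U z = (\<integral>w. U (z + \<epsilon> *\<^sub>R w) \<partial>ball_space)"
    have B0: "0 \<le> B" using B abs_ge_zero order_trans by blast
    define A where "A z = (\<integral>w. bump k t (z - x - \<epsilon> *\<^sub>R w) \<partial>ball_space)" for z
    have [measurable]: "A \<in> borel_measurable borel"
      unfolding A_def by measurable
    let ?E = "\<lambda>z. U z * (A z - bump k t (z - x) - \<epsilon>\<^sup>2 * ?\<kappa> * bump_laplacian k t (z - x))"
    have E: "\<bar>?E z\<bar> \<le> (B * (C * \<epsilon> ^ 3)) * indicator (cball x (sqrt t + 1)) z" for z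
    proof -
      have "\<bar>A z - bump k t (z - x) - \<epsilon>\<^sup>2 * ?\<kappa> * bump_laplacian k t (z - x)\<bar>
          \<le> C * \<epsilon> ^ 3 * indicator (cball x (sqrt t + 1)) z"
        using C[of \<epsilon> "z - x"] \<epsilon> by (auto simp: A_def indicator_def dist_norm norm_minus_commute)
      then show ?thesis unfolding abs_mult mult.assoc using B B0 by (intro mult_mono) (auto simp: mult.assoc)
    qed
    \<comment> \<open>\<open>U\<close> is bounded but its support may be unbounded, so integrability
      comes from the support of the kernel.\<close>
    have supp: "integrable lborel (\<lambda>z. U z * f (z - x))"
      if f: "continuous_on UNIV f" "\<And>y. sqrt t + 1 \<le> norm y \<Longrightarrow> f y = 0" for f
    proof -
      have [measurable]: "f \<in> borel_measurable borel" using f(1) by (rule borel_measurable_continuous_onI)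
      have "bounded (f ` cball 0 (sqrt t + 1))"
        using f by (intro compact_imp_bounded compact_continuous_image) (auto intro: continuous_on_subset)
      then obtain M where M: "\<And>y. norm y \<le> sqrt t + 1 \<Longrightarrow> \<bar>f y\<bar> \<le> M"
        unfolding bounded_iff real_norm_def by (metis image_eqI mem_cball_0)
      have "\<bar>U z * f (z - x)\<bar> \<le> (B * M) * indicator (cball x (sqrt t + 1)) z" for z
      proof (cases "z \<in> cball x (sqrt t + 1)")
        case True
        then have "\<bar>f (z - x)\<bar> \<le> M" by (intro M) (auto simp: dist_norm norm_minus_commute)
        then show ?thesis using True B B0 by (auto simp: abs_mult intro!: mult_mono)
      next
        case False
        then show ?thesis using f(2)[of "z - x"] by (auto simp: dist_norm norm_minus_commute)
      qed
      then show ?thesis by (intro integrable_bounded_support(1)) auto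
    qed
    have i1: "integrable lborel (\<lambda>z. U z * bump k t (z - x))"
      by (rule supp) (use t k in \<open>auto intro!: continuous_intros bump_eq_0[where R = "sqrt t"]\<close>)
    have i2: "integrable lborel (\<lambda>z. U z * bump_laplacian k t (z - x))"
      by (rule supp) (use t k in \<open>auto intro!: continuous_intros bump_laplacian_eq_0[where R = "sqrt t"]\<close>)
    have i0: "integrable lborel ?E"
      by (rule integrable_bounded_support(1)[OF _ E]) measurable
    have "integrable lborel (\<lambda>z. ?E z + U z * bump k t (z - x) + (\<epsilon>\<^sup>2 * ?\<kappa>) * (U z * bump_laplacian k t (z - x)))"
      using i0 i1 i2 by (intro Bochner_Integration.integrable_add integrable_mult_right)
    also have "(\<lambda>z. ?E z + U z * bump k t (z - x) + (\<epsilon>\<^sup>2 * ?\<kappa>) * (U z * bump_laplacian k t (z - x))) = (\<lambda>z. U z * A z)"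
      by (simp add: algebra_simps)
    finally have iA: "integrable lborel (\<lambda>z. U z * A z)" .
    have "(\<integral>z. ?E z \<partial>lborel) = (\<integral>z. U z * A z - U z * bump k t (z - x) - (\<epsilon>\<^sup>2 * ?\<kappa>) * (U z * bump_laplacian k t (z - x)) \<partial>lborel)"
      by (intro Bochner_Integration.integral_cong) (auto simp: algebra_simps)
    also have "\<dots> = (\<integral>z. U z * A z \<partial>lborel) - (\<integral>z. U z * bump k t (z - x) \<partial>lborel)
        - (\<epsilon>\<^sup>2 * ?\<kappa>) * (\<integral>z. U z * bump_laplacian k t (z - x) \<partial>lborel)"
      by (rule integral_diff_diff_cmult[symmetric]) (fact iA i1 i2)+
    also have "(\<integral>z. U z * A z \<partial>lborel) = (\<integral>z. U z * bump k t (z - x) \<partial>lborel)"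
      unfolding A_def using B k t \<epsilon> mvp by (intro integral_mean_value_bump) auto
    finally have "\<bar>(\<epsilon>\<^sup>2 * ?\<kappa>) * (\<integral>z. U z * bump_laplacian k t (z - x) \<partial>lborel)\<bar> = \<bar>\<integral>z. ?E z \<partial>lborel\<bar>"
      by simp
    also have "\<dots> \<le> (B * (C * \<epsilon> ^ 3)) * ?V"
      by (rule integrable_bounded_support(2)[OF _ E]) measurable
    finally have "(\<epsilon>\<^sup>2 * ?\<kappa>) * \<bar>\<integral>z. U z * bump_laplacian k t (z - x) \<partial>lborel\<bar> \<le> (\<epsilon>\<^sup>2 * ?\<kappa>) * (B * (C * ?V / ?\<kappa>) * \<epsilon>)"
      using \<kappa> \<epsilon> by (simp add: abs_mult power2_eq_square power3_eq_cube mult_ac)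
    then show "\<bar>\<integral>z. U z * bump_laplacian k t (z - x) \<partial>lborel\<bar> \<le> B * (C * ?V / ?\<kappa>) * \<epsilon>"
      by (rule mult_left_le_imp_le) (use \<kappa> \<epsilon> in auto)
  qed
qed

text \<open>On a closed ball inside \<open>D\<close> the distance to the frontier is bounded below,
  so from some index on the averaging radius is exactly \<open>s n\<close> there.
  \<open>mean_value_laplacian_bound\<close> makes the integrals tend to 0, and dominated convergence
  identifies their limit.\<close>

lemma weakly_harmonic_limit:
  fixes D :: "'a::euclidean_space set" and U :: "nat \<Rightarrow> 'a \<Rightarrow> real"
  assumes D: "open D" "bounded D"
    and U [measurable]: "\<And>n. U n \<in> borel_measurable borel" and B: "\<And>n z. \<bar>U n z\<bar> \<le> B"
    and s: "\<And>n. 0 < s n" "s \<longlonglongrightarrow> 0"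
    and mvp: "\<And>n z. z \<in> D \<Longrightarrow>
      U n z = (\<integral>w. U n (z + min (s n) (infdist z (frontier D)) *\<^sub>R w) \<partial>ball_space)"
    and lim: "\<And>z. z \<in> D \<Longrightarrow> (\<lambda>n. U n z) \<longlonglongrightarrow> m z"
    and m: "bounded_weight m"
    and t: "0 \<le> t" and x: "cball x (sqrt t) \<subseteq> D" and k: "4 \<le> k"
  shows "(\<integral>z. m z * bump_laplacian k t (z - x) \<partial>lborel) = 0"
proof -
  obtain C where C: "\<And>U B \<epsilon>. U \<in> borel_measurable borel \<Longrightarrow> (\<forall>z. \<bar>U z\<bar> \<le> B) \<Longrightarrow> 0 < \<epsilon> \<Longrightarrow> \<epsilon> \<le> 1 \<Longrightarrow>
      (\<forall>z\<in>cball x (sqrt t). U z = (\<integral>w. U (z + \<epsilon> *\<^sub>R w) \<partial>ball_space)) \<Longrightarrow>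
      \<bar>\<integral>z. U z * bump_laplacian k t (z - x) \<partial>lborel\<bar> \<le> B * C * \<epsilon>"
    using mean_value_laplacian_bound[OF k t, of x] by blast
  \<comment> \<open>\<open>infdist\<close> to the empty set is 0 by convention, so the frontier has
    to be shown nonempty first.\<close>
  have "x \<in> cball x (sqrt t)" using t by simp
  then have "D \<noteq> {}" using x by blast
  moreover have "D \<noteq> UNIV" using D(2) not_bounded_UNIV by blast
  ultimately have fr: "frontier D \<noteq> {}" by (simp add: frontier_eq_empty)
  have "cball x (sqrt t) \<inter> frontier D = {}" using x D(1) by (auto simp: frontier_def interior_open)
  then obtain \<delta> where \<delta>: "0 < \<delta>" "\<And>z y. z \<in> cball x (sqrt t) \<Longrightarrow> y \<in> frontier D \<Longrightarrow> \<delta> \<le> dist z y"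
    using separate_compact_closed[of "cball x (sqrt t)" "frontier D"] by auto
  have inf: "\<delta> \<le> infdist z (frontier D)" if "z \<in> cball x (sqrt t)" for z
    using \<delta>(2)[OF that] fr by (simp add: infdist_notempty le_cINF_iff[OF fr] cINF_greatest)
  have "\<forall>\<^sub>F n in sequentially. s n < min \<delta> 1"
    using s(2) \<delta>(1) by (intro order_tendstoD(2)) auto
  then have bound: "\<forall>\<^sub>F n in sequentially. norm (\<integral>z. U n z * bump_laplacian k t (z - x) \<partial>lborel) \<le> B * C * s n"
  proof eventually_elim
    case (elim n)
    have "U n z = (\<integral>w. U n (z + s n *\<^sub>R w) \<partial>ball_space)" if "z \<in> cball x (sqrt t)" for z
    proof -
      have "min (s n) (infdist z (frontier D)) = s n" using inf[OF that] elim by simp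
      moreover have "z \<in> D" using x that by blast
      ultimately show ?thesis using mvp[of z n] by simp
    qed
    then show ?case using C[OF U[of n], of B "s n"] B s(1)[of n] elim by simp
  qed
  have "(\<lambda>n. B * C * s n) \<longlonglongrightarrow> 0" using s(2) by (auto intro!: tendsto_eq_intros)
  then have lim0: "(\<lambda>n. \<integral>z. U n z * bump_laplacian k t (z - x) \<partial>lborel) \<longlonglongrightarrow> 0"
    by (rule Lim_null_comparison[OF bound])
  have [measurable]: "m \<in> borel_measurable borel" using m by (simp add: bounded_weight_def)
  have supp: "bump_laplacian k t (z - x) = 0" if "z \<notin> cball x (sqrt t)" for z
    using that t k by (intro bump_laplacian_eq_0[where R = "sqrt t"]) (auto simp: dist_norm norm_minus_commute)
  \<comment> \<open>The indicator leaves the kernel unchanged, being 1 on its support; as a weight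
    it yields the integrability of the dominating function.\<close>
  have "bounded_weight (indicator (cball x (sqrt t)) :: 'a \<Rightarrow> real)"
  proof -
    have "norm z \<le> norm x + sqrt t" if "z \<in> cball x (sqrt t)" for z
      using that norm_triangle_ineq2[of z x] by (simp add: dist_norm norm_minus_commute)
    then have "\<forall>z. norm x + sqrt t < norm z \<longrightarrow> indicator (cball x (sqrt t)) z = (0::real)"
      by (force simp: indicator_def)
    moreover have "\<forall>z. \<bar>indicator (cball x (sqrt t)) z :: real\<bar> \<le> 1" by simp
    moreover have "(indicator (cball x (sqrt t)) :: 'a \<Rightarrow> real) \<in> borel_measurable borel"
      by (intro borel_measurable_indicator) simp
    ultimately show ?thesis unfolding bounded_weight_def by blast
  qed
  then have "integrable lborel (\<lambda>z. indicator (cball x (sqrt t)) z * (B * \<bar>bump_laplacian k t (z - x)\<bar>))"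
    by (rule bounded_weight_integrable) (intro continuous_intros)
  also have "(\<lambda>z. indicator (cball x (sqrt t)) z * (B * \<bar>bump_laplacian k t (z - x)\<bar>)) = (\<lambda>z. B * \<bar>bump_laplacian k t (z - x)\<bar>)"
  proof
    show "indicator (cball x (sqrt t)) z * (B * \<bar>bump_laplacian k t (z - x)\<bar>) = B * \<bar>bump_laplacian k t (z - x)\<bar>" for z
      using supp[of z] by (cases "z \<in> cball x (sqrt t)") auto
  qed
  finally have dom: "integrable lborel (\<lambda>z. B * \<bar>bump_laplacian k t (z - x)\<bar>)" .
  have "(\<lambda>n. \<integral>z. U n z * bump_laplacian k t (z - x) \<partial>lborel) \<longlonglongrightarrow> (\<integral>z. m z * bump_laplacian k t (z - x) \<partial>lborel)"
  proof (rule integral_dominated_convergence[OF _ _ dom])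
    have "(\<lambda>n. U n z * bump_laplacian k t (z - x)) \<longlonglongrightarrow> m z * bump_laplacian k t (z - x)" for z
      using supp[of z] lim[of z] x by (cases "z \<in> cball x (sqrt t)") (auto intro!: tendsto_intros)
    then show "AE z in lborel. (\<lambda>n. U n z * bump_laplacian k t (z - x)) \<longlonglongrightarrow> m z * bump_laplacian k t (z - x)"
      by simp
    show "AE z in lborel. norm (U n z * bump_laplacian k t (z - x)) \<le> B * \<bar>bump_laplacian k t (z - x)\<bar>" for n
      using B by (auto simp: abs_mult intro!: AE_I2 mult_right_mono)
  qed measurable
  then show ?thesis using lim0 LIMSEQ_unique by blast
qed

text \<open>The relation between \<open>bump_avg m j\<close> and \<open>bump_avg m (j - 1)\<close>, its time derivative up to a factor,
  says that \<open>bump_avg m j t x\<close> is a constant multiple of \<open>t powr (j + DIM('a) / 2)\<close>.\<close>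
lemma bump_avg_eq_0:
  fixes x :: "'a::euclidean_space"
  assumes m: "bounded_weight m" and cont: "isCont m x" and m0: "m x = 0" and j: "3 \<le> j" and T: "0 < T"
    and rel: "\<And>t. 0 < t \<Longrightarrow> t \<le> T \<Longrightarrow>
      (real DIM('a) + 2 * real j) * bump_avg m j t x = 2 * real j * t * bump_avg m (j - 1) t x"
  shows "bump_avg m j T x = 0"
proof -
  define a where "a = real j + real DIM('a) / 2"
  define H where "H t = bump_avg m j t x * t powr (- a)" for t
  let ?V = "measure lborel (ball (0::'a) 1)"
  have [measurable]: "m \<in> borel_measurable borel" using m by (simp add: bounded_weight_def)
  \<comment> \<open>With \<open>rel\<close>, the time derivative says that \<open>t\<close> times
    the derivative of the average is \<open>a\<close> times the average, so the factor
    \<open>t powr (- a)\<close> makes the quotient stationary.\<close>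
  have deriv: "DERIV H t :> 0" if "0 < t" "t \<le> T" for t
  proof -
    have "DERIV H t :> real j * bump_avg m (j - 1) t x * t powr (- a) + (- a * t powr (- a - 1)) * bump_avg m j t x"
      unfolding H_def using bump_avg_time_derivative[OF m j, of t x] that
      by (auto intro!: derivative_eq_intros)
    also have "t powr (- a) = t * t powr (- a - 1)"
      using that by (simp add: powr_diff)
    also have "real j * bump_avg m (j - 1) t x * (t * t powr (- a - 1)) + (- a * t powr (- a - 1)) * bump_avg m j t x
        = t powr (- a - 1) / 2 * (2 * real j * t * bump_avg m (j - 1) t x - (real DIM('a) + 2 * real j) * bump_avg m j t x)"
      by (simp add: a_def field_simps)
    finally show ?thesis using rel[OF that] by simp
  qed
  have const: "H t = H T" if "0 < t" "t \<le> T" for t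
  proof (cases "t = T")
    case False
    have "H T = H t"
    proof (rule DERIV_isconst_end[where f = H and a = t and b = T])
      show "continuous_on {t..T} H"
        using deriv that by (intro continuous_at_imp_continuous_on ballI DERIV_isCont[OF deriv]) auto
    qed (use that deriv False in auto)
    then show ?thesis by simp
  qed simp
  \<comment> \<open>The kernel is at most \<open>t ^ j\<close> on a ball of volume
    \<open>t powr (DIM('a) / 2) * ?V\<close>. Together these are the power \<open>t powr a\<close>
    that \<open>H\<close> divides out, leaving only the size of \<open>m\<close> near
    \<open>x\<close>.\<close>
  have small: "\<bar>H t\<bar> \<le> ?V * e" if t: "0 < t" and e: "0 \<le> e" "\<And>z. z \<in> cball x (sqrt t) \<Longrightarrow> \<bar>m z\<bar> \<le> e" for t e
  proof -
    have "\<bar>m z * bump j t (z - x)\<bar> \<le> (e * t ^ j) * indicator (cball x (sqrt t)) z" for z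
    proof (cases "z \<in> cball x (sqrt t)")
      case True
      then show ?thesis using e(2)[of z] bump_le[of t j "z - x"] bump_nonneg[of j t "z - x"] t e(1)
        by (auto simp: abs_mult intro!: mult_mono)
    next
      case False
      then show ?thesis using t j bump_eq_0[of t "sqrt t" "z - x" j] by (auto simp: dist_norm norm_minus_commute)
    qed
    then have "\<bar>bump_avg m j t x\<bar> \<le> (e * t ^ j) * measure lborel (cball x (sqrt t))"
      unfolding bump_avg_def by (intro integrable_bounded_support(2)) auto
    also have "measure lborel (cball x (sqrt t)) = t powr (real DIM('a) / 2) * ?V"
    proof -
      have "measure lborel (cball x (sqrt t)) = sqrt t ^ DIM('a) * ?V"
        using t by (subst content_cball_conv_ball, subst content_ball_conv_unit_ball) auto
      also have "sqrt t ^ DIM('a) = t powr (real DIM('a) / 2)"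
        using t by (simp add: powr_half_sqrt[symmetric] powr_power)
      finally show ?thesis .
    qed
    also have "(e * t ^ j) * (t powr (real DIM('a) / 2) * ?V) = ?V * e * t powr a"
      using t by (simp add: a_def powr_add powr_realpow)
    finally have "\<bar>bump_avg m j t x\<bar> * t powr (- a) \<le> ?V * e * t powr a * t powr (- a)"
      by (rule mult_right_mono) simp
    also have "\<dots> = ?V * e" using t by (simp add: powr_minus)
    finally show ?thesis by (simp add: H_def abs_mult)
  qed
  have "\<bar>H T\<bar> \<le> ?V * e" if e: "0 < e" for e
  proof -
    obtain d where d: "0 < d" "\<And>z. dist z x < d \<Longrightarrow> \<bar>m z\<bar> < e"
      using cont e m0 unfolding continuous_at_eps_delta by (auto simp: dist_real_def)
    \<comment> \<open>Small enough that the ball of radius \<open>sqrt t\<close> lies where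
      \<open>\<bar>m z\<bar> < e\<close>, and within the range where \<open>H\<close> is
      constant.\<close>
    define t where "t = min T ((d / 2)\<^sup>2)"
    have t: "0 < t" "t \<le> T" using d T by (auto simp: t_def)
    have "sqrt t \<le> sqrt ((d / 2)\<^sup>2)" unfolding t_def by (intro real_sqrt_le_mono) simp
    then have "sqrt t < d" using d by simp
    then have "\<bar>H t\<bar> \<le> ?V * e"
      by (intro small) (use t e d(2) in \<open>auto simp: dist_commute intro!: less_imp_le\<close>)
    then show ?thesis using const[OF t] by simp
  qed
  then have "\<bar>H T\<bar> / ?V \<le> e" if "0 < e" for e
    using that content_ball_pos[of 1 "0::'a"] by (simp add: field_simps)
  then have "\<bar>H T\<bar> / ?V \<le> 0" by (meson dense_ge)
  then have "H T = 0" using content_ball_pos[of 1 "0::'a"] by (simp add: field_simps)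
  then show ?thesis using T by (simp add: H_def)
qed

section \<open>From kernel averages to harmonicity\<close>

lemma integral_bump_pos:
  assumes "0 < t" "0 < k"
  shows "0 < (\<integral>z. bump k t (z::'a::euclidean_space) \<partial>lborel)"
proof -
  have int: "integrable lborel (bump k t :: 'a \<Rightarrow> real)"
  proof (rule integrable_bounded_support(1)[where x = 0 and R = "sqrt t" and C = "t ^ k"])
    fix z :: 'a
    show "\<bar>bump k t z\<bar> \<le> t ^ k * indicat_real (cball 0 (sqrt t)) z"
      using bump_le[of t k z] bump_nonneg[of k t z] bump_eq_0[of t "sqrt t" z k] assms
      by (auto simp: indicator_def)
  qed simp
  have "(\<integral>z. bump k t (z::'a) \<partial>lborel) \<noteq> 0"
  proof
    assume "(\<integral>z. bump k t (z::'a) \<partial>lborel) = 0"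
    then have "AE z::'a in lborel. bump k t z = 0"
      using integral_nonneg_eq_0_iff_AE[OF int] by (simp add: bump_nonneg)
    then have "AE z::'a in lborel. z \<notin> ball 0 (sqrt t)"
    proof eventually_elim
      case (elim z)
      then have "t \<le> (norm z)\<^sup>2" using assms by (simp add: bump_def power2_norm_eq_inner)
      then have "sqrt t \<le> norm z" by (simp add: real_le_lsqrt)
      then show ?case by simp
    qed
    then have "emeasure lborel (ball (0::'a) (sqrt t)) = 0"
      by (subst (asm) AE_iff_measurable[where N = "ball 0 (sqrt t)"]) auto
    then show False using content_ball_pos[of "sqrt t" "0::'a"] assms by (simp add: measure_def)
  qed
  moreover have "0 \<le> (\<integral>z. bump k t (z::'a) \<partial>lborel)" by (simp add: bump_nonneg)
  ultimately show ?thesis by linarith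
qed

text \<open>\<open>harmonic_on\<close> speaks of \<open>frechet_derivative\<close> of
  \<open>u\<close> itself. On an open set where \<open>u\<close> equals an explicit
  \<open>f\<close>, uniqueness of derivatives identifies it with \<open>f'\<close>, and then the
  derivative of each partial derivative with \<open>f''\<close>. The set and the witnesses may vary
  with the point.\<close>

lemma harmonic_onI_local:
  fixes u :: "'a::euclidean_space \<Rightarrow> real"
  assumes "open D"
    and local: "\<And>x. x \<in> D \<Longrightarrow> \<exists>S f f' f''. open S \<and> x \<in> S \<and> S \<subseteq> D \<and> (\<forall>y\<in>S. u y = f y \<and>
      (f has_derivative f' y) (at y) \<and> (\<forall>b\<in>Basis. ((\<lambda>y. f' y b) has_derivative f'' b y) (at y)) \<and>
      (\<Sum>b\<in>Basis. f'' b y b) = 0) \<and> (\<forall>b\<in>Basis. \<forall>c\<in>Basis. continuous_on S (\<lambda>y. f'' b y c))"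
  shows "harmonic_on D u"
proof -
  let ?d = "\<lambda>b y. frechet_derivative u (at y) b"
  have main: "\<exists>S f' f''. open S \<and> x \<in> S \<and> (\<forall>y\<in>S. (u has_derivative f' y) (at y)) \<and>
      (\<forall>b\<in>Basis. \<forall>y\<in>S. (?d b has_derivative f'' b y) (at y)) \<and>
      (\<Sum>b\<in>Basis. f'' b x b) = (0::real) \<and> (\<forall>b\<in>Basis. \<forall>c\<in>Basis. continuous_on S (\<lambda>y. f'' b y c))"
    if x: "x \<in> D" for x
  proof -
    obtain S f f' f'' where S0: "open S" "x \<in> S" and all: "\<forall>y\<in>S. u y = f y \<and>
      (f has_derivative f' y) (at y) \<and> (\<forall>b\<in>Basis. ((\<lambda>y. f' y b) has_derivative f'' b y) (at y)) \<and>
      (\<Sum>b\<in>Basis. f'' b y b) = 0" and cont: "\<forall>b\<in>Basis. \<forall>c\<in>Basis. continuous_on S (\<lambda>y. f'' b y c)"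
      using local[OF x] by (elim exE conjE)
    have S: "open S" "x \<in> S" "\<And>y. y \<in> S \<Longrightarrow> u y = f y"
      and f': "\<And>y. y \<in> S \<Longrightarrow> (f has_derivative f' y) (at y)"
      and f'': "\<And>b y. y \<in> S \<Longrightarrow> b \<in> Basis \<Longrightarrow> ((\<lambda>y. f' y b) has_derivative f'' b y) (at y)"
      and lap: "\<And>y. y \<in> S \<Longrightarrow> (\<Sum>b\<in>Basis. f'' b y b) = 0"
      using S0 all by blast+
    have u': "(u has_derivative f' y) (at y)" if "y \<in> S" for y
      using has_derivative_transform_within_open[OF f'[OF that] S(1) that, of u] S(3) by simp
    have d: "?d b y = f' y b" if "y \<in> S" for y b
      using frechet_derivative_at[OF u'[OF that]] by simp
    have "(?d b has_derivative f'' b y) (at y)" if "y \<in> S" "b \<in> Basis" for y b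
      using has_derivative_transform_within_open[OF f''[OF that] S(1) that(1), of "?d b"] d by simp
    then show ?thesis using S(1,2) u' lap[OF S(2)] cont by blast
  qed
  show ?thesis
    unfolding harmonic_on_def
  proof (intro conjI ballI)
    show "u differentiable_on D"
      unfolding differentiable_on_def
      by (meson main differentiableI differentiable_at_withinI)
    fix b :: 'a assume b: "b \<in> Basis"
    show "?d b differentiable_on D"
      unfolding differentiable_on_def
    proof
      fix x assume "x \<in> D"
      then obtain S f'' where "x \<in> S" "\<forall>b\<in>Basis. \<forall>y\<in>S. (?d b has_derivative f'' b y) (at y)"
        using main[of x] by blast
      then have "(?d b has_derivative f'' b x) (at x)" using b by blast
      then show "?d b differentiable (at x within D)"
        using differentiableI differentiable_at_withinI by blast
    qed
    fix c :: 'a assume c: "c \<in> Basis"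
    show "continuous_on D (\<lambda>x. frechet_derivative (?d b) (at x) c)"
    proof (intro continuous_at_imp_continuous_on ballI)
      fix x assume "x \<in> D"
      then obtain S f'' where S: "open S" "x \<in> S"
        and f'': "\<And>y. y \<in> S \<Longrightarrow> (?d b has_derivative f'' b y) (at y)"
        and cont: "continuous_on S (\<lambda>y. f'' b y c)"
        using main[of x] b c by blast
      have "continuous_on S (\<lambda>x. frechet_derivative (?d b) (at x) c)"
        using cont by (rule continuous_on_eq) (metis f'' frechet_derivative_at)
      then show "isCont (\<lambda>x. frechet_derivative (?d b) (at x) c) x"
        using S by (simp add: continuous_on_eq_continuous_at)
    qed
  next
    fix x assume "x \<in> D"
    then obtain S f'' where S: "open S" "x \<in> S"
      and f'': "\<And>b y. b \<in> Basis \<Longrightarrow> y \<in> S \<Longrightarrow> (?d b has_derivative f'' b y) (at y)"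
      and lap: "(\<Sum>b\<in>Basis. f'' b x b) = 0"
      using main[of x] by blast
    have "frechet_derivative (?d b) (at x) b = f'' b x b" if "b \<in> Basis" for b
      using frechet_derivative_at[OF f''[OF that S(2)]] by simp
    then show "(\<Sum>b\<in>Basis. frechet_derivative (?d b) (at x) b) = 0" using lap by simp
  qed
qed

text \<open>The mean value property survives subtraction of a constant. Subtracting
  \<open>u x\<close> gives a weight that vanishes at \<open>x\<close>, so
  \<open>bump_avg_eq_0\<close> shows that \<open>u x\<close> is the normalised kernel average of
  \<open>u\<close>. Near each point \<open>u\<close> is thus a convolution, whose derivatives and
  Laplacian are known.\<close>

lemma mean_value_limit_harmonic:
  fixes D :: "'a::euclidean_space set" and U :: "nat \<Rightarrow> 'a \<Rightarrow> real"
  assumes D: "open D" "bounded D"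
    and U: "\<And>n. U n \<in> borel_measurable borel" and B: "\<And>n z. \<bar>U n z\<bar> \<le> B"
    and s: "\<And>n. 0 < s n" "s \<longlonglongrightarrow> 0"
    and mvp: "\<And>n z. z \<in> D \<Longrightarrow>
      U n z = (\<integral>w. U n (z + min (s n) (infdist z (frontier D)) *\<^sub>R w) \<partial>ball_space)"
    and lim: "\<And>z. z \<in> D \<Longrightarrow> (\<lambda>n. U n z) \<longlonglongrightarrow> u z"
    and u: "continuous_on D u"
  shows "harmonic_on D u"
proof -
  interpret P: prob_space "ball_space :: 'a measure" by (rule prob_space_ball_space)
  have uB: "\<bar>u z\<bar> \<le> B" if "z \<in> D" for z
    using tendsto_rabs[OF lim[OF that]] B by (auto intro: LIMSEQ_le_const2)
  obtain R where R: "\<And>z. z \<in> D \<Longrightarrow> norm z \<le> R" using D(2) by (auto simp: bounded_iff)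
  have D_meas [measurable]: "D \<in> sets borel" using D(1) by simp
  \<comment> \<open>The constant is subtracted before the cut-off. The choice \<open>c = u x\<close>
    vanishes at \<open>x\<close>; the choice \<open>c = 0\<close> represents \<open>u\<close> as a
    convolution.\<close>
  define m where "m c z = (if z \<in> D then u z - c else 0)" for c z
  have weight: "bounded_weight (m c)" for c
    unfolding bounded_weight_def
  proof (intro conjI exI allI impI)
    have "(\<lambda>z. if z \<in> D then u z - c else 0) \<in> borel_measurable borel"
      by (intro borel_measurable_continuous_on_if D_meas continuous_intros u)
    then show "m c \<in> borel_measurable borel" by (simp add: m_def[abs_def])
    show "\<bar>m c z\<bar> \<le> \<bar>B\<bar> + \<bar>c\<bar>" for z using uB[of z] by (auto simp: m_def)
    show "m c z = 0" if "R < norm z" for z using R[of z] that by (auto simp: m_def)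
  qed
  have weak: "(\<integral>z. m c z * bump_laplacian k t (z - x) \<partial>lborel) = 0"
    if "0 \<le> t" "cball x (sqrt t) \<subseteq> D" "4 \<le> k" for c k t x
  proof (rule weakly_harmonic_limit[OF D, where U = "\<lambda>n z. U n z - c" and B = "B + \<bar>c\<bar>"])
    show "(\<lambda>z. U n z - c) \<in> borel_measurable borel" for n using U by measurable
    show "\<bar>U n z - c\<bar> \<le> B + \<bar>c\<bar>" for n z using B[of n z] by linarith
    show "U n z - c = (\<integral>w. U n (z + min (s n) (infdist z (frontier D)) *\<^sub>R w) - c \<partial>ball_space)" if "z \<in> D" for n z
    proof -
      have [measurable]: "U n \<in> borel_measurable borel" by (rule U)
      have "integrable ball_space (\<lambda>w. U n (z + min (s n) (infdist z (frontier D)) *\<^sub>R w))"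
        by (rule P.integrable_const_bound[where B = B]) (use B in auto)
      then show ?thesis using mvp[OF that, of n] P.prob_space by simp
    qed
    show "(\<lambda>n. U n z - c) \<longlonglongrightarrow> m c z" if "z \<in> D" for z
      using lim[OF that] that by (auto simp: m_def intro!: tendsto_intros)
  qed (use s that weight in auto)
  \<comment> \<open>This is \<open>weak\<close> for the exponent \<open>j + 1\<close>, with the
    Laplacian rewritten by \<open>bump_laplacian_eq\<close>.\<close>
  have rel: "(real DIM('a) + 2 * real j) * bump_avg (m c) j t x = 2 * real j * t * bump_avg (m c) (j - 1) t x"
    if "0 \<le> t" "cball x (sqrt t) \<subseteq> D" "3 \<le> j" for c j t x
  proof -
    note int = bounded_weight_integrable[OF weight]
    have "0 = (\<integral>z. m c z * bump_laplacian (Suc j) t (z - x) \<partial>lborel)"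
      using weak[of t x "Suc j" c] that by simp
    also have "\<dots> = (\<integral>z. 2 * real (Suc j) * (2 * real j * t * (m c z * bump (j - 1) t (z - x))
        - (real DIM('a) + 2 * real j) * (m c z * bump j t (z - x))) \<partial>lborel)"
      using that by (intro Bochner_Integration.integral_cong refl, subst bump_laplacian_eq) (auto simp: algebra_simps)
    also have "\<dots> = 2 * real (Suc j) * (2 * real j * t * bump_avg (m c) (j - 1) t x
        - (real DIM('a) + 2 * real j) * bump_avg (m c) j t x)"
      unfolding bump_avg_def
      using int[of "\<lambda>z. bump (j - 1) t (z - x)" c] int[of "\<lambda>z. bump j t (z - x)" c]
      by (simp add: continuous_intros)
    finally show ?thesis by simp
  qed
  have mean: "bump_avg (m 0) 5 t x = u x * (\<integral>z. bump 5 t (z::'a) \<partial>lborel)"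
    if t: "0 < t" "cball x (sqrt t) \<subseteq> D" for t x
  proof -
    have xD: "x \<in> D" using t by auto
    have "isCont (m (u x)) x"
    proof -
      have "isCont (\<lambda>z. u z - u x) x"
        using u D(1) xD by (auto simp: continuous_on_eq_continuous_at intro!: continuous_intros)
      moreover have ev: "\<forall>\<^sub>F z in nhds x. u z - u x = m (u x) z"
        using eventually_nhds_in_open[OF D(1) xD] by eventually_elim (simp add: m_def)
      ultimately show ?thesis using isCont_cong[OF ev] by simp
    qed
    then have "bump_avg (m (u x)) 5 t x = 0"
    proof (rule bump_avg_eq_0[OF weight])
      fix t' assume t': "0 < t'" "t' \<le> t"
      have "cball x (sqrt t') \<subseteq> cball x (sqrt t)" using t' by (intro subset_cball real_sqrt_le_mono)
      then show "(real DIM('a) + 2 * real 5) * bump_avg (m (u x)) 5 t' x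
          = 2 * real 5 * t' * bump_avg (m (u x)) (5 - 1) t' x"
        using t t' rel[of t' x 5 "u x"] by auto
    qed (use t xD in \<open>auto simp: m_def\<close>)
    moreover have "bump_avg (m (u x)) 5 t x = (\<integral>z. m 0 z * bump 5 t (z - x) - u x * bump 5 t (z - x) \<partial>lborel)"
      unfolding bump_avg_def
    \<comment> \<open>The cut-off is invisible here: the kernel vanishes outside a ball contained in
      \<open>D\<close>.\<close>
    proof (intro Bochner_Integration.integral_cong refl)
      fix z
      show "m (u x) z * bump 5 t (z - x) = m 0 z * bump 5 t (z - x) - u x * bump 5 t (z - x)"
        using t bump_eq_0[of t "sqrt t" "z - x" 5]
        by (cases "z \<in> cball x (sqrt t)") (auto simp: m_def algebra_simps dist_norm norm_minus_commute subset_iff)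
    qed
    moreover have "integrable lborel (\<lambda>z. bump 5 t (z - x))"
    proof (rule integrable_bounded_support(1)[where x = x and R = "sqrt t" and C = "t ^ 5"])
      fix z :: 'a
      show "\<bar>bump 5 t (z - x)\<bar> \<le> t ^ 5 * indicat_real (cball x (sqrt t)) z"
        using bump_le[of t 5 "z - x"] bump_nonneg[of 5 t "z - x"] bump_eq_0[of t "sqrt t" "z - x" 5] t
        by (auto simp: indicator_def dist_norm norm_minus_commute)
    qed simp
    moreover have "integrable lborel (\<lambda>z. m 0 z * bump 5 t (z - x))"
      by (intro bounded_weight_integrable weight continuous_intros)
    moreover have "(\<integral>z. bump 5 t (z - x) \<partial>lborel) = (\<integral>z. bump 5 t (z::'a) \<partial>lborel)"
      using lborel_integral_translate[of "bump 5 t" "- x"] by simp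
    ultimately show ?thesis by (simp add: bump_avg_def)
  qed
  show ?thesis
  proof (rule harmonic_onI_local[OF D(1)])
    fix x assume "x \<in> D"
    then obtain r where r: "0 < r" "cball x r \<subseteq> D" using D(1) open_contains_cball by blast
    \<comment> \<open>Balls of radius \<open>r / 2\<close> about points of
      \<open>ball x (r / 2)\<close> stay in \<open>cball x r\<close>, so one value of
      \<open>t\<close> serves for all these points.\<close>
    define t where "t = (r / 2)\<^sup>2"
    have t: "0 < t" "sqrt t = r / 2" using r by (auto simp: t_def)
    have sub: "cball y (sqrt t) \<subseteq> D" if "y \<in> ball x (r / 2)" for y
    proof
      fix z assume "z \<in> cball y (sqrt t)"
      then have "dist x z \<le> r" using that dist_triangle[of x z y] by (simp add: t)
      then show "z \<in> D" using r by auto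
    qed
    let ?J = "\<integral>z. bump 5 t (z::'a) \<partial>lborel"
    have J: "?J > 0" using t by (intro integral_bump_pos) auto
    let ?f = "\<lambda>y. bump_avg (m 0) 5 t y * inverse ?J"
    let ?f' = "\<lambda>y h. bump_grad (m 0) 5 t y h * inverse ?J"
    let ?f'' = "\<lambda>b y h. bump_hess (m 0) 5 t b y h * inverse ?J"
    have 1: "u y = ?f y" if "y \<in> ball x (r / 2)" for y
      using mean[OF t(1) sub[OF that]] J by simp
    have 2: "(?f has_derivative ?f' y) (at y)" for y
      using t by (intro has_derivative_mult_left bump_avg_has_derivative weight) auto
    have 3: "((\<lambda>y. ?f' y b) has_derivative ?f'' b y) (at y)" for b y
      using t by (intro has_derivative_mult_left bump_grad_has_derivative weight) auto
    have 4: "(\<Sum>b\<in>Basis. ?f'' b y b) = 0" if "y \<in> ball x (r / 2)" for y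
      using weak[of t y 5 0] sub[OF that] t
      by (simp add: sum_distrib_right[symmetric] sum_bump_hess[OF weight])
    have 5: "continuous_on (ball x (r / 2)) (\<lambda>y. ?f'' b y c)" for b c
      using t by (intro continuous_intros continuous_on_bump_hess weight) auto
    show "\<exists>S f f' f''. open S \<and> x \<in> S \<and> S \<subseteq> D \<and> (\<forall>y\<in>S. u y = f y \<and>
      (f has_derivative f' y) (at y) \<and> (\<forall>b\<in>Basis. ((\<lambda>y. f' y b) has_derivative f'' b y) (at y)) \<and>
      (\<Sum>b\<in>Basis. f'' b y b) = 0) \<and> (\<forall>b\<in>Basis. \<forall>c\<in>Basis. continuous_on S (\<lambda>y. f'' b y c))"
      by (rule exI[of _ "ball x (r / 2)"], rule exI[of _ ?f], rule exI[of _ ?f'], rule exI[of _ ?f''])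
         (use 1 2 3 4 5 r in \<open>auto simp: subset_iff\<close>)
  qed
qed

section \<open>The ball walk\<close>

lemma sequence_space_ball_space: "sequence_space (ball_space :: 'a::euclidean_space measure)"
  by (intro sequence_space.intro product_prob_space.intro product_prob_space_axioms.intro
      product_sigma_finite.intro prob_space_ball_space prob_space_imp_sigma_finite)

lemma prob_space_walk_space: "prob_space (walk_space :: (nat \<Rightarrow> 'a::euclidean_space) measure)"
  unfolding walk_space_def by (intro prob_space_PiM prob_space_ball_space)

lemma space_walk_space [simp]: "space walk_space = UNIV"
  by (simp add: walk_space_def space_PiM)

lemma measurable_walk_coord: "(\<lambda>\<omega>. \<omega> n) \<in> walk_space \<rightarrow>\<^sub>M borel"
  using measurable_component_singleton[of n UNIV "\<lambda>_. ball_space :: 'a::euclidean_space measure"]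
  by (simp add: walk_space_def cong: measurable_cong_sets)

text \<open>Prepending an independent step does not change the law of the noise. This is the source
  of the Markov property at time one.\<close>

lemma distr_walk_space_case_nat:
  "distr (ball_space \<Otimes>\<^sub>M walk_space) walk_space (\<lambda>(w, \<omega>). case_nat w \<omega>)
     = (walk_space :: (nat \<Rightarrow> 'a::euclidean_space) measure)"
  unfolding walk_space_def by (rule sequence_space.PiM_iter[OF sequence_space_ball_space])

lemma measurable_walk_case_nat [measurable]:
  assumes "f \<in> M \<rightarrow>\<^sub>M borel" "g \<in> M \<rightarrow>\<^sub>M walk_space"
  shows "(\<lambda>x. case_nat (f x :: 'a::euclidean_space) (g x)) \<in> M \<rightarrow>\<^sub>M walk_space"
  using assms unfolding walk_space_def
  by (intro measurable_case_nat') (simp_all cong: measurable_cong_sets)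

text \<open>Measurability is joint in the starting point and the noise, since the mean value
  property integrates over the position after the first step.\<close>

lemma measurable_ball_walk [measurable]:
  "(\<lambda>p. ball_walk \<epsilon> D (fst p) (snd p) n) \<in> borel_measurable (borel \<Otimes>\<^sub>M walk_space)"
proof (induction n)
  case 0
  then show ?case by simp
next
  case (Suc n)
  note [measurable] = Suc measurable_compose[OF measurable_snd measurable_walk_coord]
  have [measurable]: "(\<lambda>y. infdist y (frontier D)) \<in> borel_measurable borel"
    by (intro borel_measurable_continuous_onI continuous_intros)
  show ?case unfolding ball_walk.simps by measurable
qed

lemma measurable_walk_exit:
  "(\<lambda>p. walk_exit \<epsilon> D (fst p) (snd p)) \<in> borel_measurable (borel \<Otimes>\<^sub>M walk_space)"
  unfolding walk_exit_def by measurable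

lemma measurable_walk_exit' [measurable (raw)]:
  assumes [measurable]: "f \<in> borel_measurable M" "g \<in> M \<rightarrow>\<^sub>M walk_space"
  shows "(\<lambda>x. walk_exit \<epsilon> D (f x) (g x)) \<in> borel_measurable M"
  using measurable_compose[OF measurable_Pair[OF assms] measurable_walk_exit] by simp

lemma ball_walk_case_nat:
  "ball_walk \<epsilon> D x (case_nat w \<omega>) (Suc n)
     = ball_walk \<epsilon> D (x + min \<epsilon> (infdist x (frontier D)) *\<^sub>R w) \<omega> n"
  by (induction n) simp_all

lemma walk_exit_case_nat:
  "walk_exit \<epsilon> D x (case_nat w \<omega>) = walk_exit \<epsilon> D (x + min \<epsilon> (infdist x (frontier D)) *\<^sub>R w) \<omega>"
proof -
  let ?X = "ball_walk \<epsilon> D x (case_nat w \<omega>)"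
  \<comment> \<open>Comparing the predicates that define \<open>lim\<close>, and not the limits,
    covers divergent walks as well.\<close>
  have "(\<lambda>L. ?X \<longlonglongrightarrow> L) = (\<lambda>L. (\<lambda>n. ?X (Suc n)) \<longlonglongrightarrow> L)"
    by (simp only: filterlim_sequentially_Suc)
  then show ?thesis unfolding walk_exit_def lim_def ball_walk_case_nat by simp
qed

text \<open>Zero noise freezes the walk. Preceded by one suitable step, it makes any prescribed
  point an exit value.\<close>

lemma walk_exit_zero: "walk_exit \<epsilon> D x (\<lambda>_. 0) = x"
proof -
  have "ball_walk \<epsilon> D x (\<lambda>_. 0) n = x" for n by (induction n) auto
  then have "ball_walk \<epsilon> D x (\<lambda>_. 0) = (\<lambda>_. x)" by blast
  then show ?thesis by (simp add: walk_exit_def limI)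
qed

section \<open>Where the walk can converge\<close>

text \<open>A coordinate falls into the ball of radius \<open>1/2\<close> with probability
  \<open>(1/2) ^ DIM('a) < 1\<close>. By independence, almost surely the coordinates do not stay
  there from some index on.\<close>

lemma AE_walk_not_tendsto_0:
  "AE \<omega> in (walk_space :: (nat \<Rightarrow> 'a::euclidean_space) measure). \<not> \<omega> \<longlonglongrightarrow> 0"
proof -
  interpret W: prob_space "walk_space :: (nat \<Rightarrow> 'a) measure" by (rule prob_space_walk_space)
  interpret walk: sequence_space "ball_space :: 'a measure" by (rule sequence_space_ball_space)
  let ?H = "ball (0::'a) (1/2)"
  let ?p = "measure ball_space ?H"
  have "?p = measure lborel ?H / measure lborel (ball (0::'a) 1)"
    unfolding ball_space_def using emeasure_unit_ball[where 'a='a]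
    by (subst measure_uniform_measure) (auto intro!: arg_cong2[where f = "(/)"] arg_cong2[where f = measure])
  also have "\<dots> = (1/2) ^ DIM('a)"
    using content_ball_conv_unit_ball[of "1/2" "0::'a"] content_ball_pos[of 1 "0::'a"] by simp
  also have "\<dots> < 1" using DIM_positive[where 'a='a] by (simp add: power_less_one_iff)
  finally have p: "?p < 1" .
  have null: "AE \<omega> in walk_space. \<not> (\<forall>n\<ge>m. \<omega> n \<in> ?H)" for m
  proof -
    have sets: "{\<omega>. \<forall>n\<in>N. \<omega> n \<in> ?H} \<in> sets (walk_space :: (nat \<Rightarrow> 'a) measure)" for N
    proof -
      have "{\<omega>. n \<in> N \<longrightarrow> \<omega> n \<in> ?H} \<in> sets walk_space" for n
        using measurable_sets[OF measurable_walk_coord[of n], of ?H]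
          sets.top[of "walk_space :: (nat \<Rightarrow> 'a) measure"] by (cases "n \<in> N") (auto simp: vimage_def)
      then have "(\<Inter>n. {\<omega>. n \<in> N \<longrightarrow> \<omega> n \<in> ?H}) \<in> sets walk_space" by blast
      also have "(\<Inter>n. {\<omega>. n \<in> N \<longrightarrow> \<omega> n \<in> ?H}) = {\<omega>. \<forall>n\<in>N. \<omega> n \<in> ?H}" by auto
      finally show ?thesis .
    qed
    \<comment> \<open>Keep only \<open>j\<close> consecutive conditions; independence gives the
      power, and \<open>j\<close> is arbitrary.\<close>
    have le: "measure walk_space {\<omega>. \<forall>n\<ge>m. \<omega> n \<in> ?H} \<le> ?p ^ j" for j
    proof -
      have "measure walk_space {\<omega>. \<forall>n\<ge>m. \<omega> n \<in> ?H} \<le> measure walk_space {\<omega>. \<forall>n\<in>{m..<m+j}. \<omega> n \<in> ?H}"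
        using sets by (intro W.finite_measure_mono) auto
      also have "\<dots> = measure (Pi\<^sub>M UNIV (\<lambda>_. ball_space)) {\<omega>\<in>space (Pi\<^sub>M UNIV (\<lambda>_. ball_space)). \<forall>n\<in>{m..<m+j}. \<omega> n \<in> ?H}"
        by (simp add: walk_space_def space_PiM)
      also have "\<dots> = (\<Prod>n\<in>{m..<m+j}. ?p)"
        using walk.emeasure_PiM_Collect[of "{m..<m+j}" "\<lambda>_. ?H"]
        by (intro measure_eq_emeasure_eq_ennreal) (auto simp: walk.M.emeasure_eq_measure ennreal_power)
      finally show ?thesis by simp
    qed
    have "(\<lambda>j. ?p ^ j) \<longlonglongrightarrow> 0" using p by (intro LIMSEQ_power_zero) auto
    then have "measure walk_space {\<omega>. \<forall>n\<ge>m. \<omega> n \<in> ?H} \<le> 0"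
      using le by (intro LIMSEQ_le_const) auto
    then have "measure walk_space {\<omega>. \<forall>n\<ge>m. \<omega> n \<in> ?H} = 0"
      using measure_nonneg[of walk_space "{\<omega>. \<forall>n\<ge>m. \<omega> n \<in> ?H}"] by linarith
    then have "{\<omega>. \<forall>n\<ge>m. \<omega> n \<in> ?H} \<in> null_sets walk_space"
      using sets[of "{m..}", unfolded Ball_def atLeast_iff] by (simp add: null_sets_def W.emeasure_eq_measure)
    then show ?thesis by (rule AE_not_in[THEN eventually_mono]) simp
  qed
  then have "AE \<omega> in walk_space. \<forall>m. \<not> (\<forall>n\<ge>m. \<omega> n \<in> ?H)" by (simp add: AE_all_countable)
  then show ?thesis
  proof eventually_elim
    case (elim \<omega>)
    show ?case
    proof
      assume "\<omega> \<longlonglongrightarrow> 0"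
      then have "\<forall>\<^sub>F n in sequentially. \<omega> n \<in> ?H" by (rule topological_tendstoD) auto
      then show False using elim by (auto simp: eventually_sequentially)
    qed
  qed
qed

text \<open>\<open>lim\<close> assigns this one junk value to every divergent walk.\<close>
definition divergent_limit :: "'a::topological_space" where
  "divergent_limit = (THE L. False)"

text \<open>Off the frontier the step radii would converge to a positive number while the increments
  tend to 0. Dividing one by the other forces the noise to tend to 0, which is excluded.\<close>

lemma walk_exit_cases:
  fixes D :: "'a::euclidean_space set"
  assumes fr: "frontier D \<noteq> {}" and \<epsilon>: "0 < \<epsilon>" and \<omega>: "\<not> \<omega> \<longlonglongrightarrow> 0"
  shows "walk_exit \<epsilon> D x \<omega> \<in> frontier D \<or> walk_exit \<epsilon> D x \<omega> = divergent_limit"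
proof (cases "convergent (ball_walk \<epsilon> D x \<omega>)")
  case False
  then have "(\<lambda>L. ball_walk \<epsilon> D x \<omega> \<longlonglongrightarrow> L) = (\<lambda>L. False)" by (auto simp: convergent_def)
  then show ?thesis by (simp add: walk_exit_def lim_def divergent_limit_def)
next
  case True
  let ?X = "ball_walk \<epsilon> D x \<omega>"
  let ?r = "\<lambda>y. min \<epsilon> (infdist y (frontier D))"
  define y where "y = walk_exit \<epsilon> D x \<omega>"
  have X: "?X \<longlonglongrightarrow> y" using True by (simp add: y_def walk_exit_def convergent_LIMSEQ_iff)
  have "y \<in> frontier D"
  proof (rule ccontr)
    assume "y \<notin> frontier D"
    then have "0 < infdist y (frontier D)" using fr by (intro infdist_pos_not_in_closed) auto
    then have ry: "0 < ?r y" using \<epsilon> by simp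
    have r: "(\<lambda>n. ?r (?X n)) \<longlonglongrightarrow> ?r y" by (intro tendsto_intros X)
    have "(\<lambda>n. ?X (Suc n) - ?X n) \<longlonglongrightarrow> y - y"
      by (intro tendsto_intros X LIMSEQ_Suc[OF X])
    then have "(\<lambda>n. ?r (?X n) *\<^sub>R \<omega> n) \<longlonglongrightarrow> 0" by simp
    then have "(\<lambda>n. inverse (?r (?X n)) *\<^sub>R (?r (?X n) *\<^sub>R \<omega> n)) \<longlonglongrightarrow> inverse (?r y) *\<^sub>R 0"
      using ry by (intro tendsto_scaleR tendsto_inverse r) auto
    moreover have "\<forall>\<^sub>F n in sequentially. inverse (?r (?X n)) *\<^sub>R (?r (?X n) *\<^sub>R \<omega> n) = \<omega> n"
      using order_tendstoD(1)[OF r ry]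
    proof eventually_elim
      case (elim n)
      then have "inverse (?r (?X n)) * ?r (?X n) = 1" by (intro left_inverse) linarith
      then show ?case by (simp only: scaleR_scaleR scaleR_one)
    qed
    ultimately have "\<omega> \<longlonglongrightarrow> 0" using tendsto_cong by fastforce
    then show False using \<omega> by simp
  qed
  then show ?thesis by (simp add: y_def)
qed

section \<open>The value function and its mean value property\<close>

text \<open>For the noise \<open>(z - x) / r, 0, 0, ...\<close> the walk jumps to \<open>z\<close>
  and stays there, so \<open>F\<close> is the composition of the exit payoff with a measurable map
  of \<open>z\<close>. If the payoff were measurable, \<open>F\<close> would be Borel; hence it is
  not integrable, and the integral has its default value 0.\<close>

lemma walk_value_not_measurable:
  fixes D :: "'a::euclidean_space set"
  assumes F: "F \<notin> borel_measurable borel" and r: "0 < min \<epsilon> (infdist x (frontier D))"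
  shows "walk_value \<epsilon> D F x = 0"
proof -
  let ?r = "min \<epsilon> (infdist x (frontier D))"
  have "\<not> integrable walk_space (\<lambda>\<omega>. F (walk_exit \<epsilon> D x \<omega>))"
  proof
    assume "integrable walk_space (\<lambda>\<omega>. F (walk_exit \<epsilon> D x \<omega>))"
    then have m: "(\<lambda>\<omega>. F (walk_exit \<epsilon> D x \<omega>)) \<in> borel_measurable walk_space" by simp
    \<comment> \<open>The first coordinate may lie outside the unit ball: measurability concerns the
      whole underlying space, null sets included.\<close>
    have "(\<lambda>z. case_nat ((1 / ?r) *\<^sub>R (z - x)) (\<lambda>_. 0)) \<in> borel \<rightarrow>\<^sub>M walk_space"
      by (intro measurable_walk_case_nat) auto
    from measurable_compose[OF this m] r have "F \<in> borel_measurable borel"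
      by (simp add: walk_exit_case_nat walk_exit_zero)
    then show False using F by simp
  qed
  then show ?thesis by (simp add: walk_value_def not_integrable_integral_eq)
qed

text \<open>First-step analysis: split off the first coordinate, restart the walk at the position
  reached, and integrate over the remaining noise first. The shift identity for
  \<open>walk_exit\<close> holds for every noise sequence, so this is exact for every
  \<open>x\<close>.\<close>

lemma walk_value_mean_value:
  fixes D :: "'a::euclidean_space set" and G :: "'a \<Rightarrow> real"
  assumes [measurable]: "G \<in> borel_measurable borel" and B: "\<And>z. \<bar>G z\<bar> \<le> B"
  shows "walk_value \<epsilon> D G x
    = (\<integral>w. walk_value \<epsilon> D G (x + min \<epsilon> (infdist x (frontier D)) *\<^sub>R w) \<partial>ball_space)"
proof -
  interpret W: prob_space "walk_space :: (nat \<Rightarrow> 'a) measure" by (rule prob_space_walk_space)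
  interpret P: prob_space "ball_space :: 'a measure" by (rule prob_space_ball_space)
  interpret PW: pair_prob_space "ball_space :: 'a measure" "walk_space :: (nat \<Rightarrow> 'a) measure" ..
  let ?r = "min \<epsilon> (infdist x (frontier D))"
  have "walk_value \<epsilon> D G x
      = (\<integral>\<omega>. G (walk_exit \<epsilon> D x \<omega>) \<partial>distr (ball_space \<Otimes>\<^sub>M walk_space) walk_space (\<lambda>(w, \<omega>). case_nat w \<omega>))"
    by (simp add: walk_value_def distr_walk_space_case_nat)
  also have "\<dots> = (\<integral>p. G (walk_exit \<epsilon> D x (case_nat (fst p) (snd p))) \<partial>(ball_space \<Otimes>\<^sub>M walk_space))"
    by (subst integral_distr) (auto simp: case_prod_beta)
  also have "\<dots> = (\<integral>(w, \<omega>). G (walk_exit \<epsilon> D (x + ?r *\<^sub>R w) \<omega>) \<partial>(ball_space \<Otimes>\<^sub>M walk_space))"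
    by (simp add: walk_exit_case_nat case_prod_beta')
  also have "\<dots> = (\<integral>w. (\<integral>\<omega>. G (walk_exit \<epsilon> D (x + ?r *\<^sub>R w) \<omega>) \<partial>walk_space) \<partial>ball_space)"
    by (rule PW.integral_fst[symmetric], rule PW.P.integrable_const_bound[where B = B])
       (use B in \<open>auto simp: case_prod_beta'\<close>)
  finally show ?thesis by (simp add: walk_value_def)
qed

lemma measurable_walk_value [measurable]:
  fixes D :: "'a::euclidean_space set" and G :: "'a \<Rightarrow> real"
  assumes [measurable]: "G \<in> borel_measurable borel"
  shows "walk_value \<epsilon> D G \<in> borel_measurable borel"
proof -
  interpret W: prob_space "walk_space :: (nat \<Rightarrow> 'a) measure" by (rule prob_space_walk_space)
  show ?thesis unfolding walk_value_def[abs_def] by measurable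
qed

lemma abs_walk_value_le:
  fixes D :: "'a::euclidean_space set" and G :: "'a \<Rightarrow> real"
  assumes [measurable]: "G \<in> borel_measurable borel" and B: "\<And>z. \<bar>G z\<bar> \<le> B"
  shows "\<bar>walk_value \<epsilon> D G x\<bar> \<le> B"
proof -
  interpret W: prob_space "walk_space :: (nat \<Rightarrow> 'a) measure" by (rule prob_space_walk_space)
  have int: "integrable walk_space (\<lambda>\<omega>. G (walk_exit \<epsilon> D x \<omega>))"
    by (rule W.integrable_const_bound[where B = B]) (use B in auto)
  have "norm (walk_value \<epsilon> D G x) \<le> (\<integral>\<omega>. norm (G (walk_exit \<epsilon> D x \<omega>)) \<partial>walk_space)"
    unfolding walk_value_def by (rule integral_norm_bound)
  also have "\<dots> \<le> (\<integral>\<omega>. B \<partial>(walk_space :: (nat \<Rightarrow> 'a) measure))"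
    by (rule integral_mono) (use int B in auto)
  finally show ?thesis using W.prob_space by simp
qed

text \<open>By \<open>walk_exit_cases\<close> the exit value almost surely lies on the frontier or
  equals \<open>divergent_limit\<close>, so only the payoff at these points enters the
  expectation.\<close>

lemma walk_value_cong:
  fixes D :: "'a::euclidean_space set"
  assumes "frontier D \<noteq> {}" "0 < \<epsilon>"
    and [measurable]: "F \<in> borel_measurable borel" "G \<in> borel_measurable borel"
    and eq: "\<And>y. y \<in> frontier D \<Longrightarrow> F y = G y" "F divergent_limit = G divergent_limit"
  shows "walk_value \<epsilon> D F x = walk_value \<epsilon> D G x"
  unfolding walk_value_def
proof (rule integral_cong_AE)
  show "AE \<omega> in walk_space. F (walk_exit \<epsilon> D x \<omega>) = G (walk_exit \<epsilon> D x \<omega>)"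
    using AE_walk_not_tendsto_0
  proof eventually_elim
    case (elim \<omega>)
    then show ?case using walk_exit_cases[OF assms(1,2) elim, of x] eq by auto
  qed
qed measurable

theorem theorem2p9:
  fixes D :: "'a::euclidean_space set"
    and F :: "'a \<Rightarrow> real"
    and s :: "nat \<Rightarrow> real"
    and u :: "'a \<Rightarrow> real"
  assumes "open D" and "bounded D" and "connected D"
    and "continuous_on (frontier D) F"
    and "\<And>n. s n \<in> {0<..<1}" and "strict_mono_on UNIV (\<lambda>n. - s n)" and "s \<longlonglongrightarrow> 0"
    and "continuous_on D u"
    and "\<And>K. compact K \<Longrightarrow> K \<subseteq> D \<Longrightarrow>
           uniform_limit K (\<lambda>n x. walk_value (s n) D F x) u sequentially"
  shows "harmonic_on D u"
proof (cases "D = {}")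
  case True
  then show ?thesis by (simp add: harmonic_on_def differentiable_on_def)
next
  case False
  have "D \<noteq> UNIV" using assms(2) not_bounded_UNIV by blast
  then have fr: "frontier D \<noteq> {}" using False by (simp add: frontier_eq_empty)
  have s: "0 < s n" for n using assms(5)[of n] by simp
  have conv: "(\<lambda>n. walk_value (s n) D F z) \<longlonglongrightarrow> u z" if "z \<in> D" for z
    using tendsto_uniform_limitI[OF assms(9)[of "{z}"], of z] that by simp
  have pos: "0 < min (s n) (infdist z (frontier D))" if "z \<in> D" for n z
  proof -
    have "z \<notin> frontier D" using that assms(1) by (auto simp: frontier_def interior_open)
    then show ?thesis using s[of n] infdist_pos_not_in_closed[OF frontier_closed fr] by simp
  qed
  show ?thesis
  proof (cases "F \<in> borel_measurable borel")
    case True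
    \<comment> \<open>Zero away from the possible exit values, \<open>G\<close> is bounded, because
      \<open>F\<close> is bounded on the compact frontier. By \<open>walk_value_cong\<close> it
      gives the same expectations as \<open>F\<close>.\<close>
    define G where "G y = (if y \<in> frontier D \<union> {divergent_limit} then F y else 0)" for y
    have [measurable]: "F \<in> borel_measurable borel" "frontier D \<union> {divergent_limit} \<in> sets borel"
      using True by auto
    have G [measurable]: "G \<in> borel_measurable borel" unfolding G_def by measurable
    have "bounded (F ` frontier D)"
      by (rule compact_imp_bounded[OF compact_continuous_image[OF assms(4) compact_frontier_bounded[OF assms(2)]]])
    then obtain B where B: "\<And>y. y \<in> frontier D \<Longrightarrow> \<bar>F y\<bar> \<le> B"
      by (auto simp: bounded_iff)
    have GB: "\<bar>G y\<bar> \<le> \<bar>B\<bar> + \<bar>F divergent_limit\<bar>" for y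
      using B[of y] by (auto simp: G_def)
    have FG: "walk_value (s n) D F z = walk_value (s n) D G z" for n z
      by (rule walk_value_cong[OF fr s]) (auto simp: G_def)
    show ?thesis
      by (rule mean_value_limit_harmonic[OF assms(1,2) measurable_walk_value[OF G]
            abs_walk_value_le[OF G GB] s assms(7) walk_value_mean_value[OF G GB] _ assms(8)])
         (use conv FG in simp)
  next
    case False
    \<comment> \<open>Every approximating value on \<open>D\<close> is the default 0, so the
      constant sequence 0, which trivially has the mean value property, takes the place of the walk
      values.\<close>
    have "(\<lambda>n. 0) \<longlonglongrightarrow> u z" if "z \<in> D" for z
      using conv[OF that] walk_value_not_measurable[OF False pos[OF that]] by simp
    then show ?thesis
      by (intro mean_value_limit_harmonic[OF assms(1,2), where U = "\<lambda>_ _. 0" and B = 0 and s = s])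
         (use s assms(7,8) in auto)
  qed
qed

end
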